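(* Let $\mathbf{I}$ be a small, non-empty and connected category and let $\Gamma \colon \mathbf{I} \to \mathbf{Taut}$ be a functor. Then there is an isomorphism $$\Delta\bigl[\varprojlim_I \Gamma(I)\bigr] \cong \varprojlim_I \Delta[\Gamma I].$$
   Context: A functor is taut if it preserves inverse image diagrams, i.e. pullback squares in which one leg is a monomorphism (pullbacks of a monomorphism along an arbitrary morphism). A natural transformation is taut if its naturality squares at monomorphisms are pullbacks. $\mathbf{Taut}$ is the category of taut functors $\mathbf{Set}\to\mathbf{Set}$ and taut natural transformations. Limits are computed pointwise (in the category of all functors $\mathbf{Set}\to\mathbf{Set}$); a limit of taut functors is taut. For a taut functor $F \colon \mathbf{Set} \to \mathbf{Set}$ let $j_X \colon X \to X+1$ be the coproduct injection. The difference functor of $F$ is $\Delta[F](X) = F(X+1) \setminus \mathrm{Im}\, F(j_X)$; for $f \colon X \to Y$, $\Delta[F](f)$ is the restriction of $F(f+1)$ (which does restrict, because $F$ is taut). For a taut transformation $t \colon F \to G$, $\Delta[t](X)$ is the restriction of $t(X+1)$. This makes $\Delta$ a functor $\mathbf{Taut}\to\mathbf{Taut}$, and $I \mapsto \Delta[\Gamma I]$ is the composite diagram. *)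

theory Defs
  imports "HOL-Library.FuncSet"
begin

section \<open>Categories, functors and limits\<close>

text \<open>\<open>Comp C g f\<close> is the composite of \<open>f\<close> followed by \<open>g\<close>; it is only meaningful
  for arrows with \<open>Cod C f = Dom C g\<close>.\<close>

record ('o, 'm) cat =
  Obj :: "'o set"
  Arr :: "'m set"
  Dom :: "'m \<Rightarrow> 'o"
  Cod :: "'m \<Rightarrow> 'o"
  Idn :: "'o \<Rightarrow> 'm"
  Comp :: "'m \<Rightarrow> 'm \<Rightarrow> 'm"

definition hom :: "('o, 'm) cat \<Rightarrow> 'o \<Rightarrow> 'o \<Rightarrow> 'm set" where
  "hom C a b = {f \<in> Arr C. Dom C f = a \<and> Cod C f = b}"

definition is_category :: "('o, 'm) cat \<Rightarrow> bool" where
  "is_category C \<longleftrightarrow>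
     (\<forall>f\<in>Arr C. Dom C f \<in> Obj C \<and> Cod C f \<in> Obj C) \<and>
     (\<forall>a\<in>Obj C. Idn C a \<in> hom C a a) \<and>
     (\<forall>f\<in>Arr C. \<forall>g\<in>Arr C. Cod C f = Dom C g \<longrightarrow> Comp C g f \<in> hom C (Dom C f) (Cod C g)) \<and>
     (\<forall>f\<in>Arr C. Comp C f (Idn C (Dom C f)) = f \<and> Comp C (Idn C (Cod C f)) f = f) \<and>
     (\<forall>f\<in>Arr C. \<forall>g\<in>Arr C. \<forall>h\<in>Arr C. Cod C f = Dom C g \<longrightarrow> Cod C g = Dom C h \<longrightarrow>
        Comp C h (Comp C g f) = Comp C (Comp C h g) f)"

definition nonempty_category :: "('o, 'm) cat \<Rightarrow> bool" where
  "nonempty_category C \<longleftrightarrow> Obj C \<noteq> {}"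

text \<open>Any two objects are joined by a finite zigzag of arrows.\<close>

definition connected_category :: "('o, 'm) cat \<Rightarrow> bool" where
  "connected_category C \<longleftrightarrow>
     (\<forall>a\<in>Obj C. \<forall>b\<in>Obj C.
        (a, b) \<in> ((\<lambda>f. (Dom C f, Cod C f)) ` Arr C \<union> (\<lambda>f. (Cod C f, Dom C f)) ` Arr C)\<^sup>*)"

definition isomorphic_in :: "('o, 'm) cat \<Rightarrow> 'o \<Rightarrow> 'o \<Rightarrow> bool" where
  "isomorphic_in C a b \<longleftrightarrow> a \<in> Obj C \<and> b \<in> Obj C \<and>
     (\<exists>f\<in>hom C a b. \<exists>g\<in>hom C b a. Comp C g f = Idn C a \<and> Comp C f g = Idn C b)"

definition mono_in :: "('o, 'm) cat \<Rightarrow> 'm \<Rightarrow> bool" where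
  "mono_in C m \<longleftrightarrow> m \<in> Arr C \<and>
     (\<forall>g\<in>Arr C. \<forall>h\<in>Arr C. Dom C g = Dom C h \<longrightarrow> Cod C g = Dom C m \<longrightarrow> Cod C h = Dom C m \<longrightarrow>
        Comp C m g = Comp C m h \<longrightarrow> g = h)"

text \<open>\<open>is_pullback C p q f g\<close>: the square with \<open>f \<circ> p = g \<circ> q\<close> is a pullback of the
  cospan \<open>f\<close>, \<open>g\<close>; so \<open>p\<close> is opposite to \<open>g\<close> and \<open>q\<close> is opposite to \<open>f\<close>.\<close>

definition commuting_square :: "('o, 'm) cat \<Rightarrow> 'm \<Rightarrow> 'm \<Rightarrow> 'm \<Rightarrow> 'm \<Rightarrow> bool" where
  "commuting_square C p q f g \<longleftrightarrow>
     p \<in> Arr C \<and> q \<in> Arr C \<and> f \<in> Arr C \<and> g \<in> Arr C \<and>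
     Dom C p = Dom C q \<and> Cod C p = Dom C f \<and> Cod C q = Dom C g \<and> Cod C f = Cod C g \<and>
     Comp C f p = Comp C g q"

definition is_pullback :: "('o, 'm) cat \<Rightarrow> 'm \<Rightarrow> 'm \<Rightarrow> 'm \<Rightarrow> 'm \<Rightarrow> bool" where
  "is_pullback C p q f g \<longleftrightarrow> commuting_square C p q f g \<and>
     (\<forall>p' q'. commuting_square C p' q' f g \<longrightarrow>
        (\<exists>!h. h \<in> hom C (Dom C p') (Dom C p) \<and> Comp C p h = p' \<and> Comp C q h = q'))"

record ('o, 'm, 'p, 'n) fctr =
  onObj :: "'o \<Rightarrow> 'p"
  onArr :: "'m \<Rightarrow> 'n"

text \<open>The two maps are required to be extensional, so that functors agreeing on all objects and
  arrows are equal; the same convention is used below for arrows between sets and for natural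
  transformations.\<close>

definition is_functor ::
    "('o, 'm) cat \<Rightarrow> ('p, 'n) cat \<Rightarrow> ('o, 'm, 'p, 'n) fctr \<Rightarrow> bool" where
  "is_functor C D F \<longleftrightarrow>
     onObj F \<in> extensional (Obj C) \<and> onArr F \<in> extensional (Arr C) \<and>
     (\<forall>a\<in>Obj C. onObj F a \<in> Obj D) \<and>
     (\<forall>f\<in>Arr C. onArr F f \<in> hom D (onObj F (Dom C f)) (onObj F (Cod C f))) \<and>
     (\<forall>a\<in>Obj C. onArr F (Idn C a) = Idn D (onObj F a)) \<and>
     (\<forall>f\<in>Arr C. \<forall>g\<in>Arr C. Cod C f = Dom C g \<longrightarrow>
        onArr F (Comp C g f) = Comp D (onArr F g) (onArr F f))"

definition fctr_comp :: "('o, 'm) cat \<Rightarrow> ('p, 'n, 'q, 'r) fctr \<Rightarrow> ('o, 'm, 'p, 'n) fctr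
    \<Rightarrow> ('o, 'm, 'q, 'r) fctr" where
  "fctr_comp C G F =
     \<lparr>onObj = (\<lambda>a\<in>Obj C. onObj G (onObj F a)), onArr = (\<lambda>f\<in>Arr C. onArr G (onArr F f))\<rparr>"

definition is_cone :: "('i, 'k) cat \<Rightarrow> ('o, 'm) cat \<Rightarrow> ('i, 'k, 'o, 'm) fctr
    \<Rightarrow> 'o \<Rightarrow> ('i \<Rightarrow> 'm) \<Rightarrow> bool" where
  "is_cone J C D L \<pi> \<longleftrightarrow> L \<in> Obj C \<and>
     (\<forall>i\<in>Obj J. \<pi> i \<in> hom C L (onObj D i)) \<and>
     (\<forall>u\<in>Arr J. Comp C (onArr D u) (\<pi> (Dom J u)) = \<pi> (Cod J u))"

definition is_limit :: "('i, 'k) cat \<Rightarrow> ('o, 'm) cat \<Rightarrow> ('i, 'k, 'o, 'm) fctr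
    \<Rightarrow> 'o \<Rightarrow> ('i \<Rightarrow> 'm) \<Rightarrow> bool" where
  "is_limit J C D L \<pi> \<longleftrightarrow> is_cone J C D L \<pi> \<and>
     (\<forall>L' \<pi>'. is_cone J C D L' \<pi>' \<longrightarrow>
        (\<exists>!h. h \<in> hom C L' L \<and> (\<forall>i\<in>Obj J. Comp C (\<pi> i) h = \<pi>' i)))"


section \<open>The category of sets\<close>

text \<open>Sets are taken relative to a universe: \<open>U\<close> consists of those subsets of the type \<open>'u\<close>
  that count as sets, and \<open>S\<close> of those that may serve as index sets of small diagrams. The
  intended reading is \<open>S = U\<close>, e.g. both the small subsets of a type of all ZFC sets. Only the
  closure properties that matter for forming \<open>X + 1\<close> and small limits are imposed. Keeping \<open>S\<close>
  apart from \<open>U\<close> admits universes with infinite sets and infinite index categories whose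
  existence is provable in HOL (e.g. \<open>U\<close> the sets of cardinality at most the continuum and \<open>S\<close>
  the countable sets), whereas \<open>S = U\<close> with an infinite member needs an inaccessible cardinal.

  The product of a family of members of \<open>U\<close> has another type, so it is required to have a
  bijective copy in \<open>U\<close>.\<close>

definition set_universe :: "'u set set \<Rightarrow> 'u set set \<Rightarrow> bool" where
  "set_universe U S \<longleftrightarrow>
     infinite (UNIV :: 'u set) \<and>
     {} \<in> U \<and>
     (\<forall>X\<in>U. \<forall>x. insert x X \<in> U) \<and>
     (\<forall>X\<in>U. \<forall>Y. Y \<subseteq> X \<longrightarrow> Y \<in> U) \<and>
     (\<forall>X\<in>U. \<forall>f :: 'u \<Rightarrow> 'u. f ` X \<in> U) \<and>
     (\<forall>J\<in>S. \<forall>X. (\<forall>j\<in>J. X j \<in> U) \<longrightarrow>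
        (\<exists>c :: ('u \<Rightarrow> 'u) \<Rightarrow> 'u. inj_on c (Pi\<^sub>E J X) \<and> c ` Pi\<^sub>E J X \<in> U))"

definition small_category :: "'u set set \<Rightarrow> ('o, 'm) cat \<Rightarrow> bool" where
  "small_category S C \<longleftrightarrow>
     (\<exists>J\<in>S. \<exists>b. bij_betw b (Obj C) J) \<and> (\<exists>J\<in>S. \<exists>b. bij_betw b (Arr C) J)"

datatype 'u set_arr = SetArr (src: "'u set") (fn: "'u \<Rightarrow> 'u") (tgt: "'u set")

definition set_cat :: "'u set set \<Rightarrow> ('u set, 'u set_arr) cat" where
  "set_cat U =
     \<lparr>Obj = U,
      Arr = {SetArr X f Y | X f Y. X \<in> U \<and> Y \<in> U \<and> f \<in> X \<rightarrow>\<^sub>E Y},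
      Dom = src,
      Cod = tgt,
      Idn = (\<lambda>X. SetArr X (\<lambda>x\<in>X. x) X),
      Comp = (\<lambda>g f. SetArr (src f) (\<lambda>x\<in>src f. fn g (fn f x)) (tgt g))\<rparr>"


section \<open>Functors from sets to sets\<close>

type_synonym 'u set_fctr = "('u set, 'u set_arr, 'u set, 'u set_arr) fctr"

datatype 'u nat_arr =
  NatArr (nsrc: "'u set_fctr") (at: "'u set \<Rightarrow> 'u set_arr") (ntgt: "'u set_fctr")

definition is_nat :: "'u set set \<Rightarrow> 'u nat_arr \<Rightarrow> bool" where
  "is_nat U t \<longleftrightarrow>
     is_functor (set_cat U) (set_cat U) (nsrc t) \<and>
     is_functor (set_cat U) (set_cat U) (ntgt t) \<and>
     at t \<in> extensional U \<and>
     (\<forall>X\<in>U. at t X \<in> hom (set_cat U) (onObj (nsrc t) X) (onObj (ntgt t) X)) \<and>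
     (\<forall>f\<in>Arr (set_cat U).
        Comp (set_cat U) (at t (tgt f)) (onArr (nsrc t) f) =
        Comp (set_cat U) (onArr (ntgt t) f) (at t (src f)))"

definition fun_cat :: "'u set set \<Rightarrow> ('u set_fctr, 'u nat_arr) cat" where
  "fun_cat U =
     \<lparr>Obj = {F. is_functor (set_cat U) (set_cat U) F},
      Arr = {t. is_nat U t},
      Dom = nsrc,
      Cod = ntgt,
      Idn = (\<lambda>F. NatArr F (\<lambda>X\<in>U. Idn (set_cat U) (onObj F X)) F),
      Comp = (\<lambda>s t. NatArr (nsrc t) (\<lambda>X\<in>U. Comp (set_cat U) (at s X) (at t X)) (ntgt s))\<rparr>"

definition taut_functor :: "'u set set \<Rightarrow> 'u set_fctr \<Rightarrow> bool" where
  "taut_functor U F \<longleftrightarrow>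
     is_functor (set_cat U) (set_cat U) F \<and>
     (\<forall>p q f m. is_pullback (set_cat U) p q f m \<longrightarrow> mono_in (set_cat U) m \<longrightarrow>
        is_pullback (set_cat U) (onArr F p) (onArr F q) (onArr F f) (onArr F m))"

definition taut_nat :: "'u set set \<Rightarrow> 'u nat_arr \<Rightarrow> bool" where
  "taut_nat U t \<longleftrightarrow>
     is_nat U t \<and>
     (\<forall>m. mono_in (set_cat U) m \<longrightarrow>
        is_pullback (set_cat U)
          (onArr (nsrc t) m) (at t (src m)) (at t (tgt m)) (onArr (ntgt t) m))"

definition taut_cat :: "'u set set \<Rightarrow> ('u set_fctr, 'u nat_arr) cat" where
  "taut_cat U = (fun_cat U)
     \<lparr>Obj := {F. taut_functor U F},
      Arr := {t. taut_nat U t \<and> taut_functor U (nsrc t) \<and> taut_functor U (ntgt t)}\<rparr>"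


section \<open>The difference functor\<close>

text \<open>A fixed copy of \<open>X + 1\<close> inside the type \<open>'u\<close>: the injection of \<open>X\<close> is given by \<open>inl\<close>
  and the added point is \<open>pt\<close>. Such a pair exists because \<open>'u\<close> is infinite in every universe.\<close>

definition plus_one_code :: "('u \<Rightarrow> 'u) \<times> 'u" where
  "plus_one_code = (SOME c. inj (fst c) \<and> snd c \<notin> range (fst c))"

definition inl :: "'u \<Rightarrow> 'u" where "inl = fst plus_one_code"

definition pt :: 'u where "pt = snd plus_one_code"

definition plus_one :: "'u set \<Rightarrow> 'u set" where
  "plus_one X = insert pt (inl ` X)"

definition plus_one_arr :: "'u set_arr \<Rightarrow> 'u set_arr" where
  "plus_one_arr f = SetArr (plus_one (src f))
     (\<lambda>z\<in>plus_one (src f). if z = pt then pt else inl (fn f (the_inv inl z)))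
     (plus_one (tgt f))"

definition coprod_inj :: "'u set \<Rightarrow> 'u set_arr" where
  "coprod_inj X = SetArr X (\<lambda>x\<in>X. inl x) (plus_one X)"

definition diff_set :: "'u set_fctr \<Rightarrow> 'u set \<Rightarrow> 'u set" where
  "diff_set F X = onObj F (plus_one X) - fn (onArr F (coprod_inj X)) ` onObj F X"

definition diff_fctr :: "'u set set \<Rightarrow> 'u set_fctr \<Rightarrow> 'u set_fctr" where
  "diff_fctr U F =
     \<lparr>onObj = (\<lambda>X\<in>U. diff_set F X),
      onArr = (\<lambda>f\<in>Arr (set_cat U).
        SetArr (diff_set F (src f))
               (restrict (fn (onArr F (plus_one_arr f))) (diff_set F (src f)))
               (diff_set F (tgt f)))\<rparr>"

definition diff_nat :: "'u set set \<Rightarrow> 'u nat_arr \<Rightarrow> 'u nat_arr" where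
  "diff_nat U t = NatArr (diff_fctr U (nsrc t))
     (\<lambda>X\<in>U. SetArr (diff_set (nsrc t) X)
                      (restrict (fn (at t (plus_one X))) (diff_set (nsrc t) X))
                      (diff_set (ntgt t) X))
     (diff_fctr U (ntgt t))"

definition Diff :: "'u set set \<Rightarrow> ('u set_fctr, 'u nat_arr, 'u set_fctr, 'u nat_arr) fctr" where
  "Diff U =
     \<lparr>onObj = (\<lambda>F\<in>Obj (taut_cat U). diff_fctr U F),
      onArr = (\<lambda>t\<in>Arr (taut_cat U). diff_nat U t)\<rparr>"

end

theory Submission
  imports Defs
begin

text \<open>A limit of functors is pointwise the set of compatible families. An element \<open>z\<close> of
  \<open>L (X + 1)\<close> lies in the image of \<open>L X\<close> iff each of its components \<open>\<pi>\<^sub>i z\<close> does, because maps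
  induced by monomorphisms are injective; and since the index category is connected and the
  transition maps are taut, this holds for all \<open>i\<close> as soon as it holds for one. Hence the
  projections are taut, and (with at least one index) the complement of the image consists of
  the compatible families of elements of the complements, which is the limit of the differences.\<close>

text \<open>A limit in \<open>fun_cat U\<close> is known only through its universal property, and
  compatible families have type \<open>'i \<Rightarrow> 'u\<close>, so they do not form a member of
  \<open>U\<close>. Hence one limit is built from encoded copies of the sets of families, using the
  product codes of the universe, and every other limit inherits the pointwise description through
  its isomorphism with this one. The isomorphism between the two sides is then found among all
  functors; it lies in the subcategory because an invertible transformation between taut functors is
  taut.

  Both conditions on the index category are essential. The limit of the empty diagram is constant
  with value 1, so its difference is empty, whereas the limit of the empty diagram of differences is
  1. For two nodes without connecting arrows, both carrying the identity functor, the limit is X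
  \<times> X with difference (X + 1)^2 - X^2 = 2 X + 1, whereas the product of the two differences
  is 1: a pair may leave the image in one coordinate only.\<close>

locale universe =
  fixes U S :: "'u set set"
  assumes set_universe: "set_universe U S"
begin

abbreviation SET where "SET \<equiv> set_cat U"
abbreviation FUN where "FUN \<equiv> fun_cat U"
abbreviation TAUT where "TAUT \<equiv> taut_cat U"
abbreviation set_functor where "set_functor \<equiv> is_functor SET SET"

lemma empty_in_U: "{} \<in> U"
  using set_universe by (simp add: set_universe_def)

lemma insert_in_U: "X \<in> U \<Longrightarrow> insert x X \<in> U"
  using set_universe by (simp add: set_universe_def)

lemma subset_in_U: "X \<in> U \<Longrightarrow> Y \<subseteq> X \<Longrightarrow> Y \<in> U"
  using set_universe unfolding set_universe_def by blast

lemma image_in_U: "X \<in> U \<Longrightarrow> f ` X \<in> U"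
  for f :: "'u \<Rightarrow> 'u"
  using set_universe by (simp add: set_universe_def)

lemma product_code:
  assumes "J \<in> S" and "\<And>j. j \<in> J \<Longrightarrow> X j \<in> U"
  obtains c :: "('u \<Rightarrow> 'u) \<Rightarrow> 'u" where "inj_on c (Pi\<^sub>E J X)" "c ` Pi\<^sub>E J X \<in> U"
  using set_universe assms unfolding set_universe_def by metis

section \<open>Elementwise descriptions\<close>

lemma set_cat_simps [simp]:
  "Obj SET = U" "Dom SET = src" "Cod SET = tgt" "Idn SET = (\<lambda>X. SetArr X (\<lambda>x\<in>X. x) X)"
  "Comp SET = (\<lambda>g f. SetArr (src f) (\<lambda>x\<in>src f. fn g (fn f x)) (tgt g))"
  by (simp_all add: set_cat_def)

lemma Arr_SET_iff: "f \<in> Arr SET \<longleftrightarrow> src f \<in> U \<and> tgt f \<in> U \<and> fn f \<in> src f \<rightarrow>\<^sub>E tgt f"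
  by (cases f) (auto simp: set_cat_def)

lemma hom_SET_iff:
  "f \<in> hom SET X Y \<longleftrightarrow> X \<in> U \<and> Y \<in> U \<and> src f = X \<and> tgt f = Y \<and> fn f \<in> X \<rightarrow>\<^sub>E Y"
  by (auto simp: hom_def Arr_SET_iff)

lemma Arr_SETD:
  assumes "f \<in> Arr SET"
  shows "src f \<in> U" "tgt f \<in> U" "x \<in> src f \<Longrightarrow> fn f x \<in> tgt f"
  using assms by (auto simp: Arr_SET_iff)

lemma Arr_SET_restrict:
  "X \<in> U \<Longrightarrow> Y \<in> U \<Longrightarrow> (\<And>x. x \<in> X \<Longrightarrow> h x \<in> Y) \<Longrightarrow> SetArr X (restrict h X) Y \<in> Arr SET"
  by (auto simp: Arr_SET_iff)

lemma Arr_SET_Idn: "X \<in> U \<Longrightarrow> Idn SET X \<in> Arr SET"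
  by (auto simp: Arr_SET_iff)

lemma Arr_SET_Comp:
  "f \<in> Arr SET \<Longrightarrow> g \<in> Arr SET \<Longrightarrow> tgt f = src g \<Longrightarrow> Comp SET g f \<in> Arr SET"
  by (auto simp: Arr_SET_iff)

lemma set_arr_eqI:
  assumes "f \<in> Arr SET" "g \<in> Arr SET" "src f = src g" "tgt f = tgt g"
    and "\<And>x. x \<in> src f \<Longrightarrow> fn f x = fn g x"
  shows "f = g"
proof -
  have "fn f = fn g"
    using assms by (intro PiE_ext[of _ "src f" "\<lambda>_. tgt f"]) (auto simp: Arr_SET_iff)
  with assms show ?thesis by (simp add: set_arr.expand)
qed

lemma commuting_square_SET:
  "commuting_square SET p q f g \<longleftrightarrow>
     p \<in> Arr SET \<and> q \<in> Arr SET \<and> f \<in> Arr SET \<and> g \<in> Arr SET \<and>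
     src p = src q \<and> tgt p = src f \<and> tgt q = src g \<and> tgt f = tgt g \<and>
     (\<forall>c\<in>src p. fn f (fn p c) = fn g (fn q c))"
  unfolding commuting_square_def
  by (auto simp: fun_eq_iff restrict_def)

text \<open>Elements as arrows out of a one-element set. \<open>{undefined}\<close> lies in
  \<open>U\<close> because it arises from the empty set by one \<open>insert\<close>;
  \<open>undefined\<close> is merely some inhabitant of the type. Probing a universal property with
  these arrows turns it into a statement about elements.\<close>

abbreviation point :: "'u \<Rightarrow> 'u set \<Rightarrow> 'u set_arr" where
  "point a X \<equiv> SetArr {undefined} (\<lambda>_\<in>{undefined}. a) X"

lemma point_in_Arr: "X \<in> U \<Longrightarrow> a \<in> X \<Longrightarrow> point a X \<in> Arr SET"
  by (intro Arr_SET_restrict) (auto intro: insert_in_U empty_in_U)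

text \<open>One direction probes the universal property with arrows out of the one-element set; the
  other chooses the unique element \<open>c\<close> pointwise over the source of a competing
  square.\<close>

lemma is_pullback_SET:
  "is_pullback SET p q f g \<longleftrightarrow> commuting_square SET p q f g \<and>
     (\<forall>a\<in>src f. \<forall>b\<in>src g. fn f a = fn g b \<longrightarrow>
        (\<exists>!c. c \<in> src p \<and> fn p c = a \<and> fn q c = b))"
  (is "?L \<longleftrightarrow> ?C \<and> ?E")
proof (intro iffI conjI)
  assume ?L
  then show C: ?C by (simp add: is_pullback_def)
  then have arr: "p \<in> Arr SET" "q \<in> Arr SET" "f \<in> Arr SET" "g \<in> Arr SET"
    and ends: "src p = src q" "tgt p = src f" "tgt q = src g" "tgt f = tgt g"
    by (auto simp: commuting_square_SET)
  show ?E
  proof (intro ballI impI)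
    fix a b assume a: "a \<in> src f" and b: "b \<in> src g" and eq: "fn f a = fn g b"
    let ?a = "point a (src f)" and ?b = "point b (src g)"
    have "commuting_square SET ?a ?b f g"
      using arr ends a b eq by (auto simp: commuting_square_SET intro!: point_in_Arr Arr_SETD)
    with \<open>?L\<close> have ex1: "\<exists>!h. h \<in> hom SET {undefined} (src p) \<and> Comp SET p h = ?a \<and> Comp SET q h = ?b"
      unfolding is_pullback_def by fastforce
    \<comment> \<open>An element over \<open>a\<close> and \<open>b\<close> gives an arrow competing
      with \<open>h\<close>, so the uniqueness of \<open>h\<close> passes to the element.\<close>
    have lift: "point c (src p) \<in> hom SET {undefined} (src p) \<and> Comp SET p (point c (src p)) = ?a
        \<and> Comp SET q (point c (src p)) = ?b"
      if "c \<in> src p" "fn p c = a" "fn q c = b" for c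
      using that arr ends point_in_Arr[of "src p" c] by (auto simp: hom_def Arr_SETD)
    from ex1 obtain h where h: "h \<in> hom SET {undefined} (src p)" "Comp SET p h = ?a" "Comp SET q h = ?b"
      by blast
    show "\<exists>!c. c \<in> src p \<and> fn p c = a \<and> fn q c = b"
    proof (rule ex1I[of _ "fn h undefined"])
      show "fn h undefined \<in> src p \<and> fn p (fn h undefined) = a \<and> fn q (fn h undefined) = b"
        using h by (auto simp: hom_SET_iff dest: fun_cong[of _ _ undefined])
    next
      fix c assume "c \<in> src p \<and> fn p c = a \<and> fn q c = b"
      with lift[of c] have "h = point c (src p)" using ex1 h by metis
      then show "c = fn h undefined" by simp
    qed
  qed
next
  assume "?C \<and> ?E"
  then have ?C and E: ?E by auto
  from \<open>?C\<close> have arr: "p \<in> Arr SET" "q \<in> Arr SET" "f \<in> Arr SET" "g \<in> Arr SET"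
    and ends: "src p = src q" "tgt p = src f" "tgt q = src g" "tgt f = tgt g"
    by (auto simp: commuting_square_SET)
  show ?L unfolding is_pullback_def
  proof (intro conjI allI impI)
    show ?C by fact
  next
    fix p' q' assume "commuting_square SET p' q' f g"
    then have arr': "p' \<in> Arr SET" "q' \<in> Arr SET"
      and ends': "src p' = src q'" "tgt p' = src f" "tgt q' = src g"
      and eq: "\<And>x. x \<in> src p' \<Longrightarrow> fn f (fn p' x) = fn g (fn q' x)"
      by (auto simp: commuting_square_SET)
    have "\<forall>x\<in>src p'. \<exists>c. c \<in> src p \<and> fn p c = fn p' x \<and> fn q c = fn q' x"
    proof
      fix x assume "x \<in> src p'"
      then show "\<exists>c. c \<in> src p \<and> fn p c = fn p' x \<and> fn q c = fn q' x"
        using E eq Arr_SETD(3)[OF arr'(1), of x] Arr_SETD(3)[OF arr'(2), of x] ends' by metis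
    qed
    then obtain k where k: "\<And>x. x \<in> src p' \<Longrightarrow> k x \<in> src p \<and> fn p (k x) = fn p' x \<and> fn q (k x) = fn q' x"
      by metis
    let ?h = "SetArr (src p') (restrict k (src p')) (src p)"
    have h: "?h \<in> hom SET (src p') (src p)"
      using k arr arr' by (auto simp: hom_SET_iff Arr_SETD)
    have hA: "?h \<in> Arr SET" using h by (simp add: hom_def)
    show "\<exists>!h. h \<in> hom SET (Dom SET p') (Dom SET p) \<and> Comp SET p h = p' \<and> Comp SET q h = q'"
    proof (rule ex1I[of _ ?h])
      have "Comp SET p ?h = p'"
        using k ends ends' arr' arr hA by (intro set_arr_eqI Arr_SET_Comp) auto
      moreover have "Comp SET q ?h = q'"
        using k ends ends' arr' arr hA by (intro set_arr_eqI Arr_SET_Comp) auto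
      ultimately show "?h \<in> hom SET (Dom SET p') (Dom SET p) \<and> Comp SET p ?h = p' \<and> Comp SET q ?h = q'"
        using h by simp
    next
      fix h' assume h': "h' \<in> hom SET (Dom SET p') (Dom SET p) \<and> Comp SET p h' = p' \<and> Comp SET q h' = q'"
      then have *: "h' \<in> Arr SET" "src h' = src p'" "tgt h' = src p"
        by (auto simp: hom_def)
      show "h' = ?h"
      proof (rule set_arr_eqI[OF *(1) hA])
        fix x assume x: "x \<in> src h'"
        then have "fn h' x \<in> src p" "fn p (fn h' x) = fn p' x" "fn q (fn h' x) = fn q' x"
          using h' * Arr_SETD(3)[OF *(1) x] by (auto dest!: arg_cong[of _ _ fn] fun_cong[of _ _ x])
        with k[of x] x * show "fn h' x = fn ?h x"
          using E eq[of x] Arr_SETD(3)[OF arr'(1), of x] Arr_SETD(3)[OF arr'(2), of x] ends'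
          by simp metis
      qed (use * in auto)
    qed
  qed
qed

lemma is_pullbackI:
  assumes "p \<in> Arr SET" "q \<in> Arr SET" "f \<in> Arr SET" "g \<in> Arr SET"
    and "src p = src q" "tgt p = src f" "tgt q = src g" "tgt f = tgt g"
    and "\<And>c. c \<in> src p \<Longrightarrow> fn f (fn p c) = fn g (fn q c)"
    and "\<And>a b. a \<in> src f \<Longrightarrow> b \<in> src g \<Longrightarrow> fn f a = fn g b \<Longrightarrow>
      \<exists>c\<in>src p. fn p c = a \<and> fn q c = b"
    and "\<And>c d. c \<in> src p \<Longrightarrow> d \<in> src p \<Longrightarrow> fn p c = fn p d \<Longrightarrow> fn q c = fn q d \<Longrightarrow> c = d"
  shows "is_pullback SET p q f g"
proof -
  have "\<exists>!c. c \<in> src p \<and> fn p c = a \<and> fn q c = b"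
    if "a \<in> src f" "b \<in> src g" "fn f a = fn g b" for a b
  proof -
    from assms(10)[OF that] obtain c where "c \<in> src p" "fn p c = a" "fn q c = b" by blast
    then show ?thesis using assms(11) by (intro ex1I[of _ c]) auto
  qed
  with assms(1-9) show ?thesis
    by (simp add: is_pullback_SET commuting_square_SET)
qed

lemma is_pullbackD:
  assumes "is_pullback SET p q f g"
  shows "p \<in> Arr SET" "q \<in> Arr SET" "f \<in> Arr SET" "g \<in> Arr SET"
    "src p = src q" "tgt p = src f" "tgt q = src g" "tgt f = tgt g"
    "c \<in> src p \<Longrightarrow> fn f (fn p c) = fn g (fn q c)"
  using assms by (auto simp: is_pullback_SET commuting_square_SET)

lemma is_pullback_lift:
  assumes "is_pullback SET p q f g" "a \<in> src f" "b \<in> src g" "fn f a = fn g b"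
  obtains c where "c \<in> src p" "fn p c = a" "fn q c = b"
  using assms unfolding is_pullback_SET by blast

lemma is_pullback_unique:
  assumes pb: "is_pullback SET p q f g" and "c \<in> src p" "d \<in> src p"
    and "fn p c = fn p d" "fn q c = fn q d"
  shows "c = d"
proof -
  note pbD = is_pullbackD[OF pb]
  have "fn p c \<in> src f" "fn q c \<in> src g" "fn f (fn p c) = fn g (fn q c)"
    using pbD assms(2) Arr_SETD(3) by metis+
  then have "\<exists>!e. e \<in> src p \<and> fn p e = fn p c \<and> fn q e = fn q c"
    using pb by (simp add: is_pullback_SET)
  then show ?thesis using assms(2-) by metis
qed

text \<open>Cancellation against two arrows out of the one-element set already gives
  injectivity.\<close>

lemma mono_SET: "mono_in SET m \<longleftrightarrow> m \<in> Arr SET \<and> inj_on (fn m) (src m)"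
proof
  assume L: "mono_in SET m"
  then have m: "m \<in> Arr SET" by (simp add: mono_in_def)
  have "x = y" if "x \<in> src m" "y \<in> src m" "fn m x = fn m y" for x y
  proof -
    have xy: "point x (src m) \<in> Arr SET" "point y (src m) \<in> Arr SET"
      using that m by (auto intro: point_in_Arr Arr_SETD)
    have "Comp SET m (point x (src m)) = Comp SET m (point y (src m))"
      using that by (auto simp: restrict_def fun_eq_iff)
    then have "point x (src m) = point y (src m)"
      using L xy unfolding mono_in_def set_cat_simps by (metis set_arr.sel)
    then show ?thesis by (auto dest: fun_cong[of _ _ undefined])
  qed
  with m show "m \<in> Arr SET \<and> inj_on (fn m) (src m)" by (auto intro: inj_onI)
next
  assume R: "m \<in> Arr SET \<and> inj_on (fn m) (src m)"
  show "mono_in SET m" unfolding mono_in_def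
  proof (intro conjI ballI impI)
    fix g h assume gh: "g \<in> Arr SET" "h \<in> Arr SET" "Dom SET g = Dom SET h"
      "Cod SET g = Dom SET m" "Cod SET h = Dom SET m" and eq: "Comp SET m g = Comp SET m h"
    show "g = h"
    proof (rule set_arr_eqI)
      fix x assume x: "x \<in> src g"
      have "fn m (fn g x) = fn m (fn h x)"
        using eq x gh by (auto dest: fun_cong[of _ _ x])
      then show "fn g x = fn h x"
        using R gh x Arr_SETD(3)[OF gh(1), of x] Arr_SETD(3)[OF gh(2), of x] by (auto dest: inj_onD)
    qed (use gh in auto)
  qed (use R in auto)
qed

section \<open>Set functors and natural transformations in terms of elements\<close>

lemma set_functorD:
  assumes "set_functor F"
  shows "onObj F \<in> extensional U" "onArr F \<in> extensional (Arr SET)"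
    "X \<in> U \<Longrightarrow> onObj F X \<in> U"
    "f \<in> Arr SET \<Longrightarrow> onArr F f \<in> Arr SET"
    "f \<in> Arr SET \<Longrightarrow> src (onArr F f) = onObj F (src f)"
    "f \<in> Arr SET \<Longrightarrow> tgt (onArr F f) = onObj F (tgt f)"
    "f \<in> Arr SET \<Longrightarrow> x \<in> onObj F (src f) \<Longrightarrow> fn (onArr F f) x \<in> onObj F (tgt f)"
    "X \<in> U \<Longrightarrow> x \<in> onObj F X \<Longrightarrow> fn (onArr F (Idn SET X)) x = x"
    "f \<in> Arr SET \<Longrightarrow> g \<in> Arr SET \<Longrightarrow> tgt f = src g \<Longrightarrow> x \<in> onObj F (src f) \<Longrightarrow>
       fn (onArr F (Comp SET g f)) x = fn (onArr F g) (fn (onArr F f) x)"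
proof -
  show *: "onObj F \<in> extensional U" "onArr F \<in> extensional (Arr SET)"
    "X \<in> U \<Longrightarrow> onObj F X \<in> U"
    "f \<in> Arr SET \<Longrightarrow> onArr F f \<in> Arr SET"
    "f \<in> Arr SET \<Longrightarrow> src (onArr F f) = onObj F (src f)"
    "f \<in> Arr SET \<Longrightarrow> tgt (onArr F f) = onObj F (tgt f)" for f X
    using assms by (auto simp: is_functor_def hom_def)
  show "f \<in> Arr SET \<Longrightarrow> x \<in> onObj F (src f) \<Longrightarrow> fn (onArr F f) x \<in> onObj F (tgt f)"
    using *(4-6) Arr_SETD(3) by metis
  show "X \<in> U \<Longrightarrow> x \<in> onObj F X \<Longrightarrow> fn (onArr F (Idn SET X)) x = x"
    using assms by (auto simp: is_functor_def)
  assume "f \<in> Arr SET" "g \<in> Arr SET" "tgt f = src g" "x \<in> onObj F (src f)"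
  then have "onArr F (Comp SET g f) = Comp SET (onArr F g) (onArr F f)"
    using assms by (auto simp: is_functor_def)
  then show "fn (onArr F (Comp SET g f)) x = fn (onArr F g) (fn (onArr F f) x)"
    using *(5)[OF \<open>f \<in> Arr SET\<close>] \<open>x \<in> onObj F (src f)\<close> by simp
qed

text \<open>Both the limit functor and the difference functor are defined in this shape, a family of
  sets with a restricted action \<open>h\<close>. Restriction takes care of the extensionality
  convention, so only the elementwise laws of \<open>h\<close> on \<open>A\<close> remain.\<close>

lemma set_functorI:
  assumes F: "F = \<lparr>onObj = (\<lambda>X\<in>U. A X),
      onArr = (\<lambda>f\<in>Arr SET. SetArr (A (src f)) (restrict (h f) (A (src f))) (A (tgt f)))\<rparr>"
    and obj: "\<And>X. X \<in> U \<Longrightarrow> A X \<in> U"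
    and arr: "\<And>f x. f \<in> Arr SET \<Longrightarrow> x \<in> A (src f) \<Longrightarrow> h f x \<in> A (tgt f)"
    and idn: "\<And>X x. X \<in> U \<Longrightarrow> x \<in> A X \<Longrightarrow> h (Idn SET X) x = x"
    and comp: "\<And>f g x. f \<in> Arr SET \<Longrightarrow> g \<in> Arr SET \<Longrightarrow> tgt f = src g \<Longrightarrow> x \<in> A (src f) \<Longrightarrow>
      h (Comp SET g f) x = h g (h f x)"
  shows "set_functor F"
  unfolding is_functor_def
proof (intro conjI ballI impI)
  fix f assume f: "f \<in> Arr SET"
  then show "onArr F f \<in> hom SET (onObj F (Dom SET f)) (onObj F (Cod SET f))"
    using arr obj by (auto simp: F hom_SET_iff Arr_SETD)
next
  fix X assume "X \<in> Obj SET"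
  then have X: "X \<in> U" by simp
  then show "onArr F (Idn SET X) = Idn SET (onObj F X)"
    using idn[OF X] Arr_SET_Idn[OF X] by (auto simp: F restrict_def)
next
  fix f g assume fg: "f \<in> Arr SET" "g \<in> Arr SET" "Cod SET f = Dom SET g"
  then have "Comp SET g f \<in> Arr SET" by (intro Arr_SET_Comp) auto
  then show "onArr F (Comp SET g f) = Comp SET (onArr F g) (onArr F f)"
    using comp[of f g] arr[of f] fg by (auto simp: F restrict_def fun_eq_iff)
qed (auto simp: F obj)

lemma fun_cat_simps [simp]:
  "Obj FUN = {F. set_functor F}" "Arr FUN = {t. is_nat U t}" "Dom FUN = nsrc" "Cod FUN = ntgt"
  "Idn FUN = (\<lambda>F. NatArr F (\<lambda>X\<in>U. Idn SET (onObj F X)) F)"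
  "Comp FUN = (\<lambda>s t. NatArr (nsrc t) (\<lambda>X\<in>U. Comp SET (at s X) (at t X)) (ntgt s))"
  by (simp_all add: fun_cat_def)

lemma is_natD:
  assumes "is_nat U t"
  shows "set_functor (nsrc t)" "set_functor (ntgt t)" "at t \<in> extensional U"
    "X \<in> U \<Longrightarrow> at t X \<in> Arr SET"
    "X \<in> U \<Longrightarrow> src (at t X) = onObj (nsrc t) X"
    "X \<in> U \<Longrightarrow> tgt (at t X) = onObj (ntgt t) X"
    "X \<in> U \<Longrightarrow> x \<in> onObj (nsrc t) X \<Longrightarrow> fn (at t X) x \<in> onObj (ntgt t) X"
    "f \<in> Arr SET \<Longrightarrow> x \<in> onObj (nsrc t) (src f) \<Longrightarrow>
      fn (at t (tgt f)) (fn (onArr (nsrc t) f) x) = fn (onArr (ntgt t) f) (fn (at t (src f)) x)"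
proof -
  show *: "set_functor (nsrc t)" "set_functor (ntgt t)" "at t \<in> extensional U"
    "X \<in> U \<Longrightarrow> at t X \<in> Arr SET"
    "X \<in> U \<Longrightarrow> src (at t X) = onObj (nsrc t) X"
    "X \<in> U \<Longrightarrow> tgt (at t X) = onObj (ntgt t) X" for X
    using assms by (auto simp: is_nat_def hom_def)
  show "X \<in> U \<Longrightarrow> x \<in> onObj (nsrc t) X \<Longrightarrow> fn (at t X) x \<in> onObj (ntgt t) X"
    using *(4-6) Arr_SETD(3) by metis
  assume f: "f \<in> Arr SET" and x: "x \<in> onObj (nsrc t) (src f)"
  then have "Comp SET (at t (tgt f)) (onArr (nsrc t) f) = Comp SET (onArr (ntgt t) f) (at t (src f))"
    using assms by (auto simp: is_nat_def)
  then show "fn (at t (tgt f)) (fn (onArr (nsrc t) f) x) = fn (onArr (ntgt t) f) (fn (at t (src f)) x)"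
    using f x set_functorD(5)[OF *(1) f] *(5)[of "src f"]
    by (auto dest!: fun_cong[of _ _ x] simp: Arr_SETD)
qed

text \<open>Counterpart of \<open>set_functorI\<close> for transformations whose components are
  restrictions of maps \<open>h X\<close>.\<close>

lemma is_natI:
  assumes t: "t = NatArr F (\<lambda>X\<in>U. SetArr (onObj F X) (restrict (h X) (onObj F X)) (onObj G X)) G"
    and F: "set_functor F" and G: "set_functor G"
    and arr: "\<And>X x. X \<in> U \<Longrightarrow> x \<in> onObj F X \<Longrightarrow> h X x \<in> onObj G X"
    and nat: "\<And>f x. f \<in> Arr SET \<Longrightarrow> x \<in> onObj F (src f) \<Longrightarrow>
      h (tgt f) (fn (onArr F f) x) = fn (onArr G f) (h (src f) x)"
  shows "is_nat U t"
  unfolding is_nat_def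
proof (intro conjI ballI)
  fix f assume f: "f \<in> Arr SET"
  then show "Comp SET (at t (tgt f)) (onArr (nsrc t) f) = Comp SET (onArr (ntgt t) f) (at t (src f))"
    using nat[OF f] set_functorD(5-7)[OF F f] set_functorD(5-7)[OF G f]
    by (auto simp: t Arr_SETD restrict_def fun_eq_iff)
qed (use F G arr set_functorD in \<open>auto simp: t hom_SET_iff\<close>)

lemma nat_eqI:
  assumes "is_nat U s" "is_nat U t" "nsrc s = nsrc t" "ntgt s = ntgt t"
    and "\<And>X x. X \<in> U \<Longrightarrow> x \<in> onObj (nsrc s) X \<Longrightarrow> fn (at s X) x = fn (at t X) x"
  shows "s = t"
proof -
  have "at s X = at t X" if "X \<in> U" for X
    using that assms is_natD[OF assms(1)] is_natD[OF assms(2)] by (intro set_arr_eqI) auto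
  then have "at s = at t"
    using is_natD(3)[OF assms(1)] is_natD(3)[OF assms(2)] by (auto intro: extensionalityI)
  with assms show ?thesis by (simp add: nat_arr.expand)
qed

lemma is_nat_Idn: "set_functor F \<Longrightarrow> is_nat U (Idn FUN F)"
  by (rule is_natI[where F = F and G = F and h = "\<lambda>X x. x"])
     (auto intro: set_functorD)

lemma is_nat_Comp:
  assumes s: "is_nat U s" and t: "is_nat U t" and "ntgt t = nsrc s"
  shows "is_nat U (Comp FUN s t)"
proof (rule is_natI[where F = "nsrc t" and G = "ntgt s" and h = "\<lambda>X x. fn (at s X) (fn (at t X) x)"])
  fix f x assume f: "f \<in> Arr SET" and x: "x \<in> onObj (nsrc t) (src f)"
  then have "fn (at t (src f)) x \<in> onObj (nsrc s) (src f)"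
    using is_natD(7)[OF t] assms(3) by (simp add: Arr_SETD)
  then show "fn (at s (tgt f)) (fn (at t (tgt f)) (fn (onArr (nsrc t) f) x)) =
      fn (onArr (ntgt s) f) (fn (at s (src f)) (fn (at t (src f)) x))"
    using is_natD(8)[OF t f x] is_natD(8)[OF s f] assms(3) by simp
qed (use is_natD[OF s] is_natD[OF t] assms(3) in \<open>auto simp: restrict_def fun_eq_iff\<close>)

lemma at_Comp_FUN:
  "is_nat U t \<Longrightarrow> X \<in> U \<Longrightarrow> x \<in> onObj (nsrc t) X \<Longrightarrow> fn (at (Comp FUN s t) X) x = fn (at s X) (fn (at t X) x)"
  by (simp add: is_natD)

end

section \<open>Limits of functors are computed pointwise\<close>

text \<open>Each round trip and the identity are mediating arrows from a limit cone to itself, so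
  uniqueness identifies them. The last clause keeps the compatibility with the projections, which
  \<open>is_limit_pointwise\<close> needs to carry elementwise information from one limit to the
  other.\<close>

lemma limits_isomorphic:
  assumes C: "is_category C" and L: "is_limit J C D L \<pi>" and M: "is_limit J C D M \<mu>"
  obtains f g where "f \<in> hom C L M" "g \<in> hom C M L" "Comp C g f = Idn C L" "Comp C f g = Idn C M"
    "\<And>i. i \<in> Obj J \<Longrightarrow> Comp C (\<mu> i) f = \<pi> i"
proof -
  have cL: "is_cone J C D L \<pi>" and cM: "is_cone J C D M \<mu>"
    using L M by (auto simp: is_limit_def)
  have pi: "\<pi> i \<in> hom C L (onObj D i)" and mu: "\<mu> i \<in> hom C M (onObj D i)" if "i \<in> Obj J" for i
    using cL cM that by (auto simp: is_cone_def)
  have uL: "\<exists>!h. h \<in> hom C N L \<and> (\<forall>i\<in>Obj J. Comp C (\<pi> i) h = \<nu> i)" if "is_cone J C D N \<nu>" for N \<nu>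
    using L that by (simp add: is_limit_def)
  have uM: "\<exists>!h. h \<in> hom C N M \<and> (\<forall>i\<in>Obj J. Comp C (\<mu> i) h = \<nu> i)" if "is_cone J C D N \<nu>" for N \<nu>
    using M that by (simp add: is_limit_def)
  obtain f where f: "f \<in> hom C L M" "\<And>i. i \<in> Obj J \<Longrightarrow> Comp C (\<mu> i) f = \<pi> i"
    using uM[OF cL] by blast
  obtain g where g: "g \<in> hom C M L" "\<And>i. i \<in> Obj J \<Longrightarrow> Comp C (\<pi> i) g = \<mu> i"
    using uL[OF cM] by blast
  have comp: "Comp C q p \<in> hom C a c" if "p \<in> hom C a b" "q \<in> hom C b c" for p q a b c
    using C that unfolding is_category_def hom_def by fastforce
  have assoc: "Comp C r (Comp C q p) = Comp C (Comp C r q) p"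
    if "p \<in> hom C a b" "q \<in> hom C b c" "r \<in> hom C c d" for p q r a b c d
    using C that unfolding is_category_def hom_def by auto
  have idn: "Idn C a \<in> hom C a a" if "a \<in> Obj C" for a
    using C that unfolding is_category_def by auto
  have idr: "Comp C p (Idn C a) = p" if "p \<in> hom C a b" for p a b
    using C that unfolding is_category_def hom_def by auto
  have obj: "L \<in> Obj C" "M \<in> Obj C" using cL cM by (auto simp: is_cone_def)
  have "Comp C g f = Idn C L"
    using uL[OF cL] comp[OF f(1) g(1)] idn[OF obj(1)] assoc[OF f(1) g(1) pi] idr[OF pi] f(2) g(2)
    by (metis (no_types, lifting))
  moreover have "Comp C f g = Idn C M"
    using uM[OF cM] comp[OF g(1) f(1)] idn[OF obj(2)] assoc[OF g(1) f(1) mu] idr[OF mu] f(2) g(2)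
    by (metis (no_types, lifting))
  ultimately show ?thesis using that f g by blast
qed

context universe
begin

lemma is_category_FUN: "is_category FUN"
  unfolding is_category_def
proof (intro conjI ballI impI)
  fix F assume "F \<in> Obj FUN"
  then show "Idn FUN F \<in> hom FUN F F"
    using is_nat_Idn[of F] by (simp add: hom_def)
next
  fix s t assume "s \<in> Arr FUN" "t \<in> Arr FUN" "Cod FUN s = Dom FUN t"
  then show "Comp FUN t s \<in> hom FUN (Dom FUN s) (Cod FUN t)"
    using is_nat_Comp[of t s] by (simp add: hom_def)
next
  fix s assume "s \<in> Arr FUN"
  then have s: "is_nat U s" by simp
  note sD = is_natD[OF s]
  show "Comp FUN s (Idn FUN (Dom FUN s)) = s"
    using s is_nat_Idn[OF sD(1)] by (intro nat_eqI is_nat_Comp) auto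
  show "Comp FUN (Idn FUN (Cod FUN s)) s = s"
    using s is_nat_Idn[OF sD(2)] sD by (intro nat_eqI is_nat_Comp) auto
next
  fix r s t assume "r \<in> Arr FUN" "s \<in> Arr FUN" "t \<in> Arr FUN" "Cod FUN r = Dom FUN s" "Cod FUN s = Dom FUN t"
  then have "is_nat U r" "is_nat U s" "is_nat U t" "ntgt r = nsrc s" "ntgt s = nsrc t" by auto
  then show "Comp FUN t (Comp FUN s r) = Comp FUN (Comp FUN t s) r"
    using is_nat_Comp[of s r] is_nat_Comp[of t s] is_natD(7)[of r]
    by (intro nat_eqI is_nat_Comp) (simp_all add: is_natD)
qed (auto dest: is_natD)

end

section \<open>Compatible families and pointwise limits of a diagram of functors\<close>

locale diagram = universe U S for U S :: "'u set set" +
  fixes I :: "('i, 'k) cat" and D :: "('i, 'k, 'u set_fctr, 'u nat_arr) fctr"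
  assumes I: "is_category I" and D: "is_functor I (fun_cat U) D"
begin

lemma ends_in_I: "u \<in> Arr I \<Longrightarrow> Dom I u \<in> Obj I" "u \<in> Arr I \<Longrightarrow> Cod I u \<in> Obj I"
  using I by (auto simp: is_category_def)

lemma node_functor: "i \<in> Obj I \<Longrightarrow> set_functor (onObj D i)"
  using D by (auto simp: is_functor_def[of I])

lemma edge_nat:
  assumes "u \<in> Arr I"
  shows "is_nat U (onArr D u)" "nsrc (onArr D u) = onObj D (Dom I u)"
    "ntgt (onArr D u) = onObj D (Cod I u)"
  using D assms by (auto simp: is_functor_def[of I] hom_def)

text \<open>The usual construction of the limit of the sets at stage \<open>X\<close>. The product
  is extensional, so a family is determined by its values on \<open>Obj I\<close>.\<close>

definition families :: "'u set \<Rightarrow> ('i \<Rightarrow> 'u) set" where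
  "families X = {x \<in> (\<Pi>\<^sub>E i\<in>Obj I. onObj (onObj D i) X).
     \<forall>u\<in>Arr I. fn (at (onArr D u) X) (x (Dom I u)) = x (Cod I u)}"

text \<open>The components of any \<open>z\<close> form a family because of the cone condition, so
  this says that taking components is a bijection from \<open>onObj L X\<close> onto
  \<open>families X\<close>. Equality of the two sets is impossible for reasons of type.\<close>

definition pointwise_limit :: "'u set_fctr \<Rightarrow> ('i \<Rightarrow> 'u nat_arr) \<Rightarrow> bool" where
  "pointwise_limit L \<pi> \<longleftrightarrow> is_cone I FUN D L \<pi> \<and>
     (\<forall>X\<in>U. \<forall>x\<in>families X. \<exists>!z. z \<in> onObj L X \<and> (\<forall>i\<in>Obj I. fn (at (\<pi> i) X) z = x i))"

lemma familiesI:
  assumes "\<And>i. i \<in> Obj I \<Longrightarrow> x i \<in> onObj (onObj D i) X"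
    and "\<And>u. u \<in> Arr I \<Longrightarrow> fn (at (onArr D u) X) (x (Dom I u)) = x (Cod I u)"
  shows "restrict x (Obj I) \<in> families X"
  using assms ends_in_I by (auto simp: families_def)

lemma coneD:
  assumes "is_cone I FUN D L \<pi>"
  shows "set_functor L"
    "i \<in> Obj I \<Longrightarrow> is_nat U (\<pi> i)" "i \<in> Obj I \<Longrightarrow> nsrc (\<pi> i) = L"
    "i \<in> Obj I \<Longrightarrow> ntgt (\<pi> i) = onObj D i"
    "u \<in> Arr I \<Longrightarrow> X \<in> U \<Longrightarrow> z \<in> onObj L X \<Longrightarrow>
      fn (at (onArr D u) X) (fn (at (\<pi> (Dom I u)) X) z) = fn (at (\<pi> (Cod I u)) X) z"
proof -
  show *: "set_functor L"
    "i \<in> Obj I \<Longrightarrow> is_nat U (\<pi> i)" "i \<in> Obj I \<Longrightarrow> nsrc (\<pi> i) = L"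
    "i \<in> Obj I \<Longrightarrow> ntgt (\<pi> i) = onObj D i" for i
    using assms by (auto simp: is_cone_def hom_def)
  assume u: "u \<in> Arr I" and X: "X \<in> U" and z: "z \<in> onObj L X"
  then have "Comp FUN (onArr D u) (\<pi> (Dom I u)) = \<pi> (Cod I u)"
    using assms by (simp add: is_cone_def)
  then show "fn (at (onArr D u) X) (fn (at (\<pi> (Dom I u)) X) z) = fn (at (\<pi> (Cod I u)) X) z"
    using at_Comp_FUN[OF *(2)[of "Dom I u"] X, of z "onArr D u"] *(3)[of "Dom I u"] ends_in_I[OF u] z
    by simp
qed

lemma coneI:
  assumes L: "set_functor L"
    and pi: "\<And>i. i \<in> Obj I \<Longrightarrow> is_nat U (\<pi> i)" "\<And>i. i \<in> Obj I \<Longrightarrow> nsrc (\<pi> i) = L"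
      "\<And>i. i \<in> Obj I \<Longrightarrow> ntgt (\<pi> i) = onObj D i"
    and eq: "\<And>u X z. u \<in> Arr I \<Longrightarrow> X \<in> U \<Longrightarrow> z \<in> onObj L X \<Longrightarrow>
      fn (at (onArr D u) X) (fn (at (\<pi> (Dom I u)) X) z) = fn (at (\<pi> (Cod I u)) X) z"
  shows "is_cone I FUN D L \<pi>"
proof -
  have "Comp FUN (onArr D u) (\<pi> (Dom I u)) = \<pi> (Cod I u)" if u: "u \<in> Arr I" for u
  proof (rule nat_eqI)
    show "is_nat U (Comp FUN (onArr D u) (\<pi> (Dom I u)))"
      using pi edge_nat[OF u] ends_in_I[OF u] by (intro is_nat_Comp) auto
  next
    fix X z assume "X \<in> U" "z \<in> onObj (nsrc (Comp FUN (onArr D u) (\<pi> (Dom I u)))) X"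
    then show "fn (at (Comp FUN (onArr D u) (\<pi> (Dom I u))) X) z = fn (at (\<pi> (Cod I u)) X) z"
      using pi eq[OF u] ends_in_I[OF u] by (subst at_Comp_FUN) auto
  qed (use pi edge_nat[OF u] ends_in_I[OF u] in auto)
  with L pi show ?thesis by (simp add: is_cone_def hom_def)
qed

lemma cone_at:
  assumes c: "is_cone I FUN D L \<pi>" and i: "i \<in> Obj I"
  shows "X \<in> U \<Longrightarrow> z \<in> onObj L X \<Longrightarrow> fn (at (\<pi> i) X) z \<in> onObj (onObj D i) X"
    "f \<in> Arr SET \<Longrightarrow> z \<in> onObj L (src f) \<Longrightarrow>
      fn (at (\<pi> i) (tgt f)) (fn (onArr L f) z) = fn (onArr (onObj D i) f) (fn (at (\<pi> i) (src f)) z)"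
  using is_natD(7,8)[OF coneD(2)[OF c i]] coneD(3,4)[OF c i] by auto

lemma pointwise_limit_cone: "pointwise_limit L \<pi> \<Longrightarrow> is_cone I FUN D L \<pi>"
  by (simp add: pointwise_limit_def)

lemma pointwise_limitI:
  assumes "is_cone I FUN D L \<pi>"
    and "\<And>X x. X \<in> U \<Longrightarrow> x \<in> families X \<Longrightarrow> \<exists>z\<in>onObj L X. \<forall>i\<in>Obj I. fn (at (\<pi> i) X) z = x i"
    and "\<And>X z z'. X \<in> U \<Longrightarrow> z \<in> onObj L X \<Longrightarrow> z' \<in> onObj L X \<Longrightarrow>
      (\<And>i. i \<in> Obj I \<Longrightarrow> fn (at (\<pi> i) X) z = fn (at (\<pi> i) X) z') \<Longrightarrow> z = z'"
  shows "pointwise_limit L \<pi>"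
  unfolding pointwise_limit_def
proof (intro conjI ballI assms(1))
  fix X x assume X: "X \<in> U" and x: "x \<in> families X"
  from assms(2)[OF this] obtain z where "z \<in> onObj L X" "\<forall>i\<in>Obj I. fn (at (\<pi> i) X) z = x i" by blast
  then show "\<exists>!z. z \<in> onObj L X \<and> (\<forall>i\<in>Obj I. fn (at (\<pi> i) X) z = x i)"
    using assms(3)[OF X] by (intro ex1I[of _ z]) auto
qed

lemma pointwise_limit_lift:
  assumes "pointwise_limit L \<pi>" and "X \<in> U"
    and "\<And>i. i \<in> Obj I \<Longrightarrow> x i \<in> onObj (onObj D i) X"
    and "\<And>u. u \<in> Arr I \<Longrightarrow> fn (at (onArr D u) X) (x (Dom I u)) = x (Cod I u)"
  obtains z where "z \<in> onObj L X" "\<And>i. i \<in> Obj I \<Longrightarrow> fn (at (\<pi> i) X) z = x i"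
proof -
  have "restrict x (Obj I) \<in> families X" using assms by (intro familiesI) auto
  with assms(1,2) have "\<exists>!z. z \<in> onObj L X \<and> (\<forall>i\<in>Obj I. fn (at (\<pi> i) X) z = restrict x (Obj I) i)"
    unfolding pointwise_limit_def by blast
  then show ?thesis using that by auto
qed

text \<open>The components of \<open>z\<close> form a compatible family, and \<open>z\<close> and
  \<open>z'\<close> both realise it. Joint injectivity of the projections is the main device below
  for proving equations in a limit.\<close>

lemma pointwise_limit_eqI:
  assumes L: "pointwise_limit L \<pi>" and X: "X \<in> U" and z: "z \<in> onObj L X" "z' \<in> onObj L X"
    and eq: "\<And>i. i \<in> Obj I \<Longrightarrow> fn (at (\<pi> i) X) z = fn (at (\<pi> i) X) z'"
  shows "z = z'"
proof -
  have c: "is_cone I FUN D L \<pi>" by (rule pointwise_limit_cone[OF L])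
  have "restrict (\<lambda>i. fn (at (\<pi> i) X) z) (Obj I) \<in> families X" (is "?x \<in> _")
    using X z coneD(5)[OF c] cone_at(1)[OF c] by (intro familiesI) auto
  with L X have "\<exists>!z. z \<in> onObj L X \<and> (\<forall>i\<in>Obj I. fn (at (\<pi> i) X) z = ?x i)"
    unfolding pointwise_limit_def by blast
  moreover have "\<forall>i\<in>Obj I. fn (at (\<pi> i) X) z = ?x i" "\<forall>i\<in>Obj I. fn (at (\<pi> i) X) z' = ?x i"
    using eq by auto
  ultimately show ?thesis using z by (metis (no_types, lifting))
qed

text \<open>The components of an element of \<open>L'\<close> under the competing cone form a
  family, and gluing this family defines the mediating transformation one element at a time.\<close>

lemma pointwise_limit_is_limit:
  assumes L: "pointwise_limit L \<pi>"
  shows "is_limit I FUN D L \<pi>"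
  unfolding is_limit_def
proof (intro conjI allI impI)
  have c: "is_cone I FUN D L \<pi>" by (rule pointwise_limit_cone[OF L])
  then show "is_cone I FUN D L \<pi>" .
  fix L' \<pi>' assume c': "is_cone I FUN D L' \<pi>'"
  have "\<exists>z\<in>onObj L X. \<forall>i\<in>Obj I. fn (at (\<pi> i) X) z = fn (at (\<pi>' i) X) z'"
    if *: "X \<in> U" "z' \<in> onObj L' X" for X z'
  proof -
    obtain z where "z \<in> onObj L X" "\<And>i. i \<in> Obj I \<Longrightarrow> fn (at (\<pi> i) X) z = fn (at (\<pi>' i) X) z'"
      using pointwise_limit_lift[OF L *(1), of "\<lambda>i. fn (at (\<pi>' i) X) z'"]
        cone_at(1)[OF c' _ *] coneD(5)[OF c' _ *] by blast
    then show ?thesis by blast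
  qed
  then obtain k where k: "\<And>X z'. X \<in> U \<Longrightarrow> z' \<in> onObj L' X \<Longrightarrow> k X z' \<in> onObj L X"
    "\<And>X z' i. X \<in> U \<Longrightarrow> z' \<in> onObj L' X \<Longrightarrow> i \<in> Obj I \<Longrightarrow> fn (at (\<pi> i) X) (k X z') = fn (at (\<pi>' i) X) z'"
    by metis
  define h where "h = NatArr L' (\<lambda>X\<in>U. SetArr (onObj L' X) (restrict (k X) (onObj L' X)) (onObj L X)) L"
  have nat: "is_nat U h"
    using h_def
  proof (rule is_natI)
    fix f x assume f: "f \<in> Arr SET" and x: "x \<in> onObj L' (src f)"
    note fD = Arr_SETD(1,2)[OF f]
    have kf: "k (src f) x \<in> onObj L (src f)" "fn (onArr L' f) x \<in> onObj L' (tgt f)"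
      using k f x fD coneD(1)[OF c'] by (auto intro: set_functorD)
    \<comment> \<open>The values of \<open>k\<close> are chosen elementwise; naturality holds
      nevertheless, because both sides have the same projections.\<close>
    show "k (tgt f) (fn (onArr L' f) x) = fn (onArr L f) (k (src f) x)"
    proof (rule pointwise_limit_eqI[OF L fD(2)])
      fix i assume i: "i \<in> Obj I"
      have "fn (at (\<pi> i) (tgt f)) (k (tgt f) (fn (onArr L' f) x)) =
          fn (onArr (onObj D i) f) (fn (at (\<pi>' i) (src f)) x)"
        using k(2)[OF fD(2) kf(2) i] cone_at(2)[OF c' i f x] by simp
      also have "\<dots> = fn (at (\<pi> i) (tgt f)) (fn (onArr L f) (k (src f) x))"
        using k(2)[OF fD(1) x i] cone_at(2)[OF c i f kf(1)] by simp
      finally show "fn (at (\<pi> i) (tgt f)) (k (tgt f) (fn (onArr L' f) x)) =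
          fn (at (\<pi> i) (tgt f)) (fn (onArr L f) (k (src f) x))" .
    next
      show "k (tgt f) (fn (onArr L' f) x) \<in> onObj L (tgt f)" by (rule k(1)[OF fD(2) kf(2)])
      show "fn (onArr L f) (k (src f) x) \<in> onObj L (tgt f)"
        using set_functorD(7)[OF coneD(1)[OF c] f kf(1)] .
    qed
  qed (use k coneD(1)[OF c] coneD(1)[OF c'] in auto)
  \<comment> \<open>The mediating equations are brought into elementwise form for every candidate
    \<open>g\<close>: existence reads the equivalence from right to left, uniqueness from left to
    right.\<close>
  have comp_eq_iff: "(\<forall>i\<in>Obj I. Comp FUN (\<pi> i) g = \<pi>' i) \<longleftrightarrow>
      (\<forall>i\<in>Obj I. \<forall>X\<in>U. \<forall>x\<in>onObj L' X. fn (at (\<pi> i) X) (fn (at g X) x) = fn (at (\<pi>' i) X) x)"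
    if "is_nat U g" "nsrc g = L'" "ntgt g = L" for g
  proof (intro ball_cong refl iffI ballI)
    fix i X x assume "i \<in> Obj I" "Comp FUN (\<pi> i) g = \<pi>' i" "X \<in> U" "x \<in> onObj L' X"
    then show "fn (at (\<pi> i) X) (fn (at g X) x) = fn (at (\<pi>' i) X) x"
      using at_Comp_FUN[OF that(1), of X x "\<pi> i"] that(2) by simp
  next
    fix i assume i: "i \<in> Obj I" and
      *: "\<forall>X\<in>U. \<forall>x\<in>onObj L' X. fn (at (\<pi> i) X) (fn (at g X) x) = fn (at (\<pi>' i) X) x"
    show "Comp FUN (\<pi> i) g = \<pi>' i"
    proof (rule nat_eqI)
      show "is_nat U (Comp FUN (\<pi> i) g)"
        using that coneD[OF c] i by (intro is_nat_Comp) auto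
    next
      fix X x assume "X \<in> U" "x \<in> onObj (nsrc (Comp FUN (\<pi> i) g)) X"
      then show "fn (at (Comp FUN (\<pi> i) g) X) x = fn (at (\<pi>' i) X) x"
        using * that by (subst at_Comp_FUN) auto
    qed (use i that coneD[OF c] coneD[OF c'] in auto)
  qed
  show "\<exists>!h. h \<in> hom FUN L' L \<and> (\<forall>i\<in>Obj I. Comp FUN (\<pi> i) h = \<pi>' i)"
  proof (rule ex1I[of _ h])
    have "nsrc h = L'" "ntgt h = L" by (simp_all add: h_def)
    with nat have "\<forall>i\<in>Obj I. Comp FUN (\<pi> i) h = \<pi>' i"
      by (subst comp_eq_iff) (auto simp: h_def k)
    then show "h \<in> hom FUN L' L \<and> (\<forall>i\<in>Obj I. Comp FUN (\<pi> i) h = \<pi>' i)"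
      using nat by (simp add: hom_def h_def)
  next
    fix g assume g: "g \<in> hom FUN L' L \<and> (\<forall>i\<in>Obj I. Comp FUN (\<pi> i) g = \<pi>' i)"
    then have gD: "is_nat U g" "nsrc g = L'" "ntgt g = L" by (auto simp: hom_def)
    with g have eq: "\<And>i X x. i \<in> Obj I \<Longrightarrow> X \<in> U \<Longrightarrow> x \<in> onObj L' X \<Longrightarrow>
        fn (at (\<pi> i) X) (fn (at g X) x) = fn (at (\<pi>' i) X) x"
      using comp_eq_iff by blast
    show "g = h"
    proof (rule nat_eqI[OF gD(1) nat])
      fix X x assume X: "X \<in> U" and "x \<in> onObj (nsrc g) X"
      then have x: "x \<in> onObj L' X" by (simp add: gD)
      have "fn (at g X) x = k X x"
      proof (rule pointwise_limit_eqI[OF L X])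
        fix i assume i: "i \<in> Obj I"
        show "fn (at (\<pi> i) X) (fn (at g X) x) = fn (at (\<pi> i) X) (k X x)"
          using eq[OF i X x] k(2)[OF X x i] by simp
      next
        show "fn (at g X) x \<in> onObj L X" using is_natD(7)[OF gD(1) X, of x] x gD by simp
      qed (rule k(1)[OF X x])
      then show "fn (at g X) x = fn (at h X) x" using X x by (simp add: h_def)
    qed (simp_all add: gD h_def)
  qed
qed

section \<open>Existence of pointwise limits, and pointwise nature of all limits\<close>

lemma families_map:
  assumes f: "f \<in> Arr SET" and x: "x \<in> families (src f)"
  shows "(\<lambda>i\<in>Obj I. fn (onArr (onObj D i) f) (x i)) \<in> families (tgt f)"
proof (rule familiesI)
  fix i assume i: "i \<in> Obj I"
  then have "x i \<in> onObj (onObj D i) (src f)" using x by (auto simp: families_def)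
  then show "fn (onArr (onObj D i) f) (x i) \<in> onObj (onObj D i) (tgt f)"
    using node_functor[OF i] f by (auto intro: set_functorD)
next
  fix u assume u: "u \<in> Arr I"
  then have "x (Dom I u) \<in> onObj (onObj D (Dom I u)) (src f)"
    "fn (at (onArr D u) (src f)) (x (Dom I u)) = x (Cod I u)"
    using x ends_in_I by (auto simp: families_def)
  then show "fn (at (onArr D u) (tgt f)) (fn (onArr (onObj D (Dom I u)) f) (x (Dom I u))) =
      fn (onArr (onObj D (Cod I u)) f) (x (Cod I u))"
    using is_natD(8)[OF edge_nat(1)[OF u] f] edge_nat(2,3)[OF u] by simp
qed

text \<open>The universe codes only products indexed by a member of \<open>S\<close>. Smallness
  identifies \<open>Obj I\<close> with such a member \<open>J\<close>, and the families become a
  subset of a coded product, so closure under subsets applies.\<close>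

lemma families_code:
  assumes small: "small_category S I" and X: "X \<in> U"
  shows "\<exists>e. inj_on e (families X) \<and> e ` families X \<in> U"
proof -
  from small obtain J b where J: "J \<in> S" and b: "bij_betw b (Obj I) J"
    unfolding small_category_def by blast
  let ?b' = "inv_into (Obj I) b"
  have b': "?b' j \<in> Obj I" if "j \<in> J" for j
    using b that by (metis bij_betw_def inv_into_into)
  have bb: "?b' (b i) = i" "b i \<in> J" if "i \<in> Obj I" for i
    using b that by (auto simp: bij_betw_def)
  obtain c :: "('u \<Rightarrow> 'u) \<Rightarrow> 'u" where c: "inj_on c (\<Pi>\<^sub>E j\<in>J. onObj (onObj D (?b' j)) X)"
    "c ` (\<Pi>\<^sub>E j\<in>J. onObj (onObj D (?b' j)) X) \<in> U"
    using product_code[OF J, of "\<lambda>j. onObj (onObj D (?b' j)) X"] b' X node_functor set_functorD(3)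
    by metis
  \<comment> \<open>Reindexing a family along the inverse of \<open>b\<close>. Nothing is lost,
    since every node \<open>i\<close> equals \<open>?b' (b i)\<close>.\<close>
  let ?r = "\<lambda>x. \<lambda>j\<in>J. x (?b' j)"
  have r: "?r ` families X \<subseteq> (\<Pi>\<^sub>E j\<in>J. onObj (onObj D (?b' j)) X)"
    using b' by (auto simp: families_def)
  have "inj_on ?r (families X)"
  proof (rule inj_onI)
    fix x y assume x: "x \<in> families X" and y: "y \<in> families X" and eq: "?r x = ?r y"
    have "x i = y i" if "i \<in> Obj I" for i
      using fun_cong[OF eq, of "b i"] bb[OF that] by simp
    then show "x = y"
      using x y by (intro PiE_ext[of x "Obj I" "\<lambda>i. onObj (onObj D i) X"]) (auto simp: families_def)
  qed
  then have "inj_on (c \<circ> ?r) (families X)"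
    using r c(1) by (intro comp_inj_on) (auto intro: inj_on_subset)
  moreover have "(c \<circ> ?r) ` families X \<in> U"
    using c(2) by (rule subset_in_U) (use r in \<open>auto simp: image_comp[symmetric]\<close>)
  ultimately show ?thesis by blast
qed

text \<open>The componentwise action on families is transported along the codes: decode, act,
  encode. The projections decode and evaluate at a node.\<close>

lemma pointwise_limit_exists:
  assumes small: "small_category S I"
  shows "\<exists>L \<pi>. pointwise_limit L \<pi>"
proof -
  obtain e where e: "\<And>X. X \<in> U \<Longrightarrow> inj_on (e X) (families X)" "\<And>X. X \<in> U \<Longrightarrow> e X ` families X \<in> U"
    using families_code[OF small] by metis
  \<comment> \<open>Decoding; it inverts \<open>e X\<close> on the coded families, which are all
    that \<open>L\<close> contains.\<close>
  define d where "d X = inv_into (families X) (e X)" for X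
  have de [simp]: "d X (e X x) = x" if "X \<in> U" "x \<in> families X" for X x
    using that e(1) by (simp add: d_def)
  let ?A = "\<lambda>X. e X ` families X"
  let ?m = "\<lambda>f x. \<lambda>i\<in>Obj I. fn (onArr (onObj D i) f) (x i)"
  let ?h = "\<lambda>f z. e (tgt f) (?m f (d (src f) z))"
  define L :: "'u set_fctr" where "L = \<lparr>onObj = (\<lambda>X\<in>U. ?A X),
      onArr = (\<lambda>f\<in>Arr SET. SetArr (?A (src f)) (restrict (?h f) (?A (src f))) (?A (tgt f)))\<rparr>"
  have fam: "x i \<in> onObj (onObj D i) X" if "x \<in> families X" "i \<in> Obj I" for x i X
    using that by (auto simp: families_def)
  have fam_ext: "x = y" if "x \<in> families X" "y \<in> families X" "\<And>i. i \<in> Obj I \<Longrightarrow> x i = y i" for x y X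
    using that by (intro PiE_ext[of x "Obj I" "\<lambda>i. onObj (onObj D i) X"]) (auto simp: families_def)
  have L: "set_functor L"
    using L_def
  proof (rule set_functorI)
    fix f z assume f: "f \<in> Arr SET" "z \<in> ?A (src f)"
    then show "?h f z \<in> ?A (tgt f)"
      by (auto simp: Arr_SETD intro!: imageI families_map)
  next
    fix X z assume X: "X \<in> U" and z: "z \<in> ?A X"
    then obtain x where x: "x \<in> families X" "z = e X x" by blast
    have "?m (Idn SET X) x = x"
      using X x families_map[OF Arr_SET_Idn[OF X], of x] fam node_functor set_functorD(8)
      by (intro fam_ext[of _ X]) auto
    then show "?h (Idn SET X) z = z" using X x by simp
  next
    fix f g z assume f: "f \<in> Arr SET" and g: "g \<in> Arr SET" and fg: "tgt f = src g" and z: "z \<in> ?A (src f)"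
    then obtain x where x: "x \<in> families (src f)" "z = e (src f) x" by blast
    have gf: "Comp SET g f \<in> Arr SET" using f g fg by (rule Arr_SET_Comp)
    have m: "?m f x \<in> families (src g)" using families_map[OF f x(1)] fg by simp
    have "?m (Comp SET g f) x = ?m g (?m f x)"
      using set_functorD(9)[OF node_functor f g fg fam[OF x(1)]] by (auto simp: restrict_def fun_eq_iff)
    then show "?h (Comp SET g f) z = ?h g (?h f z)"
      using x fg m f g by (simp add: Arr_SETD)
  qed (use e in auto)
  define \<pi> where "\<pi> i = NatArr L (\<lambda>X\<in>U. SetArr (onObj L X) (restrict (\<lambda>z. d X z i) (onObj L X))
      (onObj (onObj D i) X)) (onObj D i)" for i
  have pi_at: "fn (at (\<pi> i) X) (e X x) = x i" if "X \<in> U" "x \<in> families X" for i X x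
    using that by (simp add: \<pi>_def L_def)
  have obj: "onObj L X = ?A X" if "X \<in> U" for X using that by (simp add: L_def)
  have pi: "is_nat U (\<pi> i)" if i: "i \<in> Obj I" for i
    using \<pi>_def[of i] L node_functor[OF i]
  proof (rule is_natI)
    fix f z assume f: "f \<in> Arr SET" and z: "z \<in> onObj L (src f)"
    then obtain x where "x \<in> families (src f)" "z = e (src f) x" by (auto simp: obj Arr_SETD)
    then show "d (tgt f) (fn (onArr L f) z) i = fn (onArr (onObj D i) f) (d (src f) z i)"
      using f i families_map[OF f] by (simp add: L_def Arr_SETD)
  qed (use i fam in \<open>auto simp: obj\<close>)
  have "is_cone I FUN D L \<pi>"
  proof (rule coneI[OF L pi])
    fix u X z assume "u \<in> Arr I" "X \<in> U" "z \<in> onObj L X"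
    then show "fn (at (onArr D u) X) (fn (at (\<pi> (Dom I u)) X) z) = fn (at (\<pi> (Cod I u)) X) z"
      by (auto simp: obj pi_at) (simp add: families_def)
  qed (simp_all add: \<pi>_def)
  then have "pointwise_limit L \<pi>"
  proof (rule pointwise_limitI)
    fix X x assume "X \<in> U" "x \<in> families X"
    then show "\<exists>z\<in>onObj L X. \<forall>i\<in>Obj I. fn (at (\<pi> i) X) z = x i"
      by (intro bexI[of _ "e X x"]) (auto simp: obj pi_at)
  next
    fix X z z' assume X: "X \<in> U" and z: "z \<in> onObj L X" "z' \<in> onObj L X"
      and eq: "\<And>i. i \<in> Obj I \<Longrightarrow> fn (at (\<pi> i) X) z = fn (at (\<pi> i) X) z'"
    from X z obtain x x' where "x \<in> families X" "x' \<in> families X" "z = e X x" "z' = e X x'"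
      by (auto simp: obj)
    moreover from this have "x = x'" using eq X by (intro fam_ext) (auto simp: pi_at)
    ultimately show "z = z'" by simp
  qed
  then show ?thesis by blast
qed

text \<open>The given limit is compared with the constructed one \<open>M\<close>. The comparison
  maps \<open>f\<close> and \<open>g\<close> are inverse to each other in every component and
  respect the projections, so gluing and joint injectivity carry over from \<open>M\<close>.\<close>

lemma is_limit_pointwise:
  assumes small: "small_category S I" and L: "is_limit I FUN D L \<pi>"
  shows "pointwise_limit L \<pi>"
proof -
  obtain M \<mu> where M: "pointwise_limit M \<mu>" using pointwise_limit_exists[OF small] by blast
  obtain f g where f: "f \<in> hom FUN L M" and g: "g \<in> hom FUN M L"
    and gf: "Comp FUN g f = Idn FUN L" and fg: "Comp FUN f g = Idn FUN M"
    and mu: "\<And>i. i \<in> Obj I \<Longrightarrow> Comp FUN (\<mu> i) f = \<pi> i"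
    using limits_isomorphic[OF is_category_FUN L pointwise_limit_is_limit[OF M]] by blast
  have fD: "is_nat U f" "nsrc f = L" "ntgt f = M" using f by (auto simp: hom_def)
  have gD: "is_nat U g" "nsrc g = M" "ntgt g = L" using g by (auto simp: hom_def)
  have gfx: "fn (at g X) (fn (at f X) z) = z" if "X \<in> U" "z \<in> onObj L X" for X z
    using at_Comp_FUN[OF fD(1), of X z g] that fD by (simp only: gf) simp
  have fgx: "fn (at f X) (fn (at g X) z) = z" if "X \<in> U" "z \<in> onObj M X" for X z
    using at_Comp_FUN[OF gD(1), of X z f] that gD by (simp only: fg) simp
  have pi: "fn (at (\<pi> i) X) z = fn (at (\<mu> i) X) (fn (at f X) z)"
    if "i \<in> Obj I" "X \<in> U" "z \<in> onObj L X" for i X z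
    using at_Comp_FUN[OF fD(1), of X z "\<mu> i"] that fD by (simp only: mu)
  have c: "is_cone I FUN D L \<pi>" using L by (simp add: is_limit_def)
  then show ?thesis
  proof (rule pointwise_limitI)
    fix X x assume X: "X \<in> U" and x: "x \<in> families X"
    obtain z where z: "z \<in> onObj M X" "\<And>i. i \<in> Obj I \<Longrightarrow> fn (at (\<mu> i) X) z = x i"
      by (rule pointwise_limit_lift[OF M X, of x]) (use x in \<open>auto simp: families_def\<close>)
    \<comment> \<open>The gluing takes place in \<open>M\<close>, and \<open>g\<close> carries the
      result to \<open>L\<close>; \<open>pi\<close> and \<open>fgx\<close> show that the components
      are unchanged.\<close>
    then show "\<exists>z\<in>onObj L X. \<forall>i\<in>Obj I. fn (at (\<pi> i) X) z = x i"
      using X fgx pi is_natD(7)[OF gD(1) X] gD by (intro bexI[of _ "fn (at g X) z"]) auto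
  next
    fix X z z' assume X: "X \<in> U" and z: "z \<in> onObj L X" "z' \<in> onObj L X"
      and eq: "\<And>i. i \<in> Obj I \<Longrightarrow> fn (at (\<pi> i) X) z = fn (at (\<pi> i) X) z'"
    have "fn (at f X) z = fn (at f X) z'"
    proof (rule pointwise_limit_eqI[OF M X])
      fix i assume i: "i \<in> Obj I"
      show "fn (at (\<mu> i) X) (fn (at f X) z) = fn (at (\<mu> i) X) (fn (at f X) z')"
        using eq[OF i] pi[OF i X] z by simp
    qed (use z is_natD(7)[OF fD(1) X] fD in auto)
    then show "z = z'" using gfx X z by metis
  qed
qed

end

context universe
begin

section \<open>Taut functors and taut transformations\<close>

lemma taut_cat_simps [simp]:
  "Obj TAUT = {F. taut_functor U F}"
  "Arr TAUT = {t. taut_nat U t \<and> taut_functor U (nsrc t) \<and> taut_functor U (ntgt t)}"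
  "Dom TAUT = nsrc" "Cod TAUT = ntgt" "Idn TAUT = Idn FUN" "Comp TAUT = Comp FUN"
  by (simp_all add: taut_cat_def fun_cat_def)

lemma mono_pullback:
  assumes pb: "is_pullback SET p q f m" and m: "mono_in SET m"
  shows "mono_in SET p"
proof -
  note D = is_pullbackD[OF pb]
  have "c = d" if "c \<in> src p" "d \<in> src p" "fn p c = fn p d" for c d
  proof -
    have "fn m (fn q c) = fn m (fn q d)" using D(9)[of c] D(9)[of d] that by simp
    moreover have "fn q c \<in> src m" "fn q d \<in> src m"
      using Arr_SETD(3)[OF D(2)] D(5,7) that by simp_all
    ultimately have "fn q c = fn q d" using m by (auto simp: mono_SET dest: inj_onD)
    then show ?thesis using is_pullback_unique[OF pb] that by blast
  qed
  then show ?thesis using D(1) by (auto simp: mono_SET intro: inj_onI)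
qed

lemma taut_set_functor: "taut_functor U F \<Longrightarrow> set_functor F"
  by (simp add: taut_functor_def)

lemma taut_nat_is_nat: "taut_nat U t \<Longrightarrow> is_nat U t"
  by (simp add: taut_nat_def)

lemma taut_functor_pullback:
  "taut_functor U F \<Longrightarrow> is_pullback SET p q f m \<Longrightarrow> mono_in SET m \<Longrightarrow>
    is_pullback SET (onArr F p) (onArr F q) (onArr F f) (onArr F m)"
  by (simp add: taut_functor_def)

text \<open>A monomorphism has a trivial kernel pair: the square with two identities over
  \<open>m\<close> and \<open>m\<close> is a pullback along a monomorphism, so a taut functor
  preserves it.\<close>

lemma taut_functor_inj:
  assumes F: "taut_functor U F" and m: "mono_in SET m"
  shows "inj_on (fn (onArr F m)) (onObj F (src m))"
proof -
  note FD = set_functorD[OF taut_set_functor[OF F]]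
  have mA: "m \<in> Arr SET" using m by (simp add: mono_SET)
  let ?i = "Idn SET (src m)"
  have i: "?i \<in> Arr SET" using mA by (intro Arr_SET_Idn) (rule Arr_SETD)
  have "is_pullback SET ?i ?i m m"
    using i mA m by (intro is_pullbackI) (auto simp: mono_SET dest: inj_onD)
  then have pb: "is_pullback SET (onArr F ?i) (onArr F ?i) (onArr F m) (onArr F m)"
    using taut_functor_pullback[OF F] m by blast
  show ?thesis
  proof (rule inj_onI)
    fix x y assume x: "x \<in> onObj F (src m)" "y \<in> onObj F (src m)"
      "fn (onArr F m) x = fn (onArr F m) y"
    \<comment> \<open>Both legs of the preserved square are the same arrow, so a common lift of
      \<open>x\<close> and \<open>y\<close> makes them equal.\<close>
    obtain c where "c \<in> src (onArr F ?i)" "fn (onArr F ?i) c = x" "fn (onArr F ?i) c = y"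
      using is_pullback_lift[OF pb, of x y] x FD(5)[OF mA] by auto
    then show "x = y" by simp
  qed
qed

text \<open>For inclusions this is the nontrivial inclusion in the equation between F applied to an
  inverse image and the inverse image under \<open>F f\<close>. By \<open>taut_functorI\<close>, it
  amounts to tautness once monomorphisms are sent to injections.\<close>

lemma taut_functor_lift:
  assumes F: "taut_functor U F" and pb: "is_pullback SET p q f m" and m: "mono_in SET m"
    and a: "a \<in> onObj F (src f)" and b: "b \<in> onObj F (src m)"
    and eq: "fn (onArr F f) a = fn (onArr F m) b"
  shows "a \<in> fn (onArr F p) ` onObj F (src p)"
proof -
  note FD = set_functorD[OF taut_set_functor[OF F]] and D = is_pullbackD[OF pb]
  obtain c where "c \<in> src (onArr F p)" "fn (onArr F p) c = a"
    using is_pullback_lift[OF taut_functor_pullback[OF F pb m], of a b] a b eq FD(5) D by metis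
  then show ?thesis using FD(5)[OF D(1)] by auto
qed

lemma set_functor_square:
  assumes F: "set_functor F" and pb: "is_pullback SET p q f m" and c: "c \<in> onObj F (src p)"
  shows "fn (onArr F f) (fn (onArr F p) c) = fn (onArr F m) (fn (onArr F q) c)"
proof -
  note D = is_pullbackD[OF pb]
  have "Comp SET f p = Comp SET m q"
    using pb unfolding is_pullback_def commuting_square_def by (elim conjE)
  then show ?thesis
    using set_functorD(9)[OF F D(1) D(3) D(6) c] set_functorD(9)[OF F D(2) D(4) D(7)] c D(5)
    by simp
qed

text \<open>Existence of a lift along \<open>p\<close> alone is enough: the equation along
  \<open>q\<close> follows by cancelling the injective \<open>onArr F m\<close>, and uniqueness
  holds because \<open>p\<close>, a pullback of \<open>m\<close>, is monic as well.\<close>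

lemma taut_functorI:
  assumes F: "set_functor F"
    and inj: "\<And>m. mono_in SET m \<Longrightarrow> inj_on (fn (onArr F m)) (onObj F (src m))"
    and lift: "\<And>p q f m a b. is_pullback SET p q f m \<Longrightarrow> mono_in SET m \<Longrightarrow>
      a \<in> onObj F (src f) \<Longrightarrow> b \<in> onObj F (src m) \<Longrightarrow> fn (onArr F f) a = fn (onArr F m) b \<Longrightarrow>
      a \<in> fn (onArr F p) ` onObj F (src p)"
  shows "taut_functor U F"
  unfolding taut_functor_def
proof (intro conjI allI impI F)
  fix p q f m assume pb: "is_pullback SET p q f m" and m: "mono_in SET m"
  note D = is_pullbackD[OF pb] and FD = set_functorD[OF F] and sq = set_functor_square[OF F pb]
  show "is_pullback SET (onArr F p) (onArr F q) (onArr F f) (onArr F m)"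
  proof (rule is_pullbackI)
    fix a b assume "a \<in> src (onArr F f)" "b \<in> src (onArr F m)" and eq: "fn (onArr F f) a = fn (onArr F m) b"
    then have ab: "a \<in> onObj F (src f)" "b \<in> onObj F (src m)" using D FD by auto
    from lift[OF pb m this eq] obtain c where c: "c \<in> onObj F (src p)" "a = fn (onArr F p) c" by blast
    then have "fn (onArr F m) (fn (onArr F q) c) = fn (onArr F m) b" using sq eq by simp
    moreover have "fn (onArr F q) c \<in> onObj F (src m)" using c FD(7)[OF D(2)] D by simp
    ultimately have "fn (onArr F q) c = b" using inj_onD[OF inj[OF m]] ab by blast
    with c show "\<exists>c\<in>src (onArr F p). fn (onArr F p) c = a \<and> fn (onArr F q) c = b"
      using FD(5)[OF D(1)] by auto
  next
    fix c d assume "c \<in> src (onArr F p)" "d \<in> src (onArr F p)" "fn (onArr F p) c = fn (onArr F p) d"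
    then show "c = d" using inj_onD[OF inj[OF mono_pullback[OF pb m]]] FD(5)[OF D(1)] by simp
  qed (use D FD sq in auto)
qed

lemma taut_nat_lift:
  assumes t: "taut_nat U t" and m: "mono_in SET m"
    and a: "a \<in> onObj (nsrc t) (tgt m)" and b: "b \<in> onObj (ntgt t) (src m)"
    and eq: "fn (at t (tgt m)) a = fn (onArr (ntgt t) m) b"
  shows "a \<in> fn (onArr (nsrc t) m) ` onObj (nsrc t) (src m)"
proof -
  have nat: "is_nat U t" and mA: "m \<in> Arr SET" using t m by (auto simp: taut_nat_def mono_SET)
  have pb: "is_pullback SET (onArr (nsrc t) m) (at t (src m)) (at t (tgt m)) (onArr (ntgt t) m)"
    using t m by (simp add: taut_nat_def)
  obtain c where "c \<in> src (onArr (nsrc t) m)" "fn (onArr (nsrc t) m) c = a"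
    using is_pullback_lift[OF pb, of a b] a b eq is_natD(5)[OF nat, of "tgt m"] Arr_SETD[OF mA]
      set_functorD(5)[OF is_natD(2)[OF nat] mA] by metis
  then show ?thesis using set_functorD(5)[OF is_natD(1)[OF nat] mA] by auto
qed

text \<open>Tautness of the two functors makes their values at \<open>m\<close> injective. On the
  target side this yields the second leg of the lift, on the source side its uniqueness, so only a
  preimage of \<open>a\<close> has to be found.\<close>

lemma taut_natI:
  assumes t: "is_nat U t" and F: "taut_functor U (nsrc t)" and G: "taut_functor U (ntgt t)"
    and lift: "\<And>m a b. mono_in SET m \<Longrightarrow> a \<in> onObj (nsrc t) (tgt m) \<Longrightarrow> b \<in> onObj (ntgt t) (src m) \<Longrightarrow>
      fn (at t (tgt m)) a = fn (onArr (ntgt t) m) b \<Longrightarrow>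
      a \<in> fn (onArr (nsrc t) m) ` onObj (nsrc t) (src m)"
  shows "taut_nat U t"
  unfolding taut_nat_def
proof (intro conjI allI impI t)
  fix m assume m: "mono_in SET m"
  then have mA: "m \<in> Arr SET" by (simp add: mono_SET)
  note tD = is_natD[OF t] and mD = Arr_SETD(1,2)[OF mA]
  note FD = set_functorD[OF tD(1)] and GD = set_functorD[OF tD(2)]
  show "is_pullback SET (onArr (nsrc t) m) (at t (src m)) (at t (tgt m)) (onArr (ntgt t) m)"
  proof (rule is_pullbackI)
    fix a b assume "a \<in> src (at t (tgt m))" "b \<in> src (onArr (ntgt t) m)"
      and eq: "fn (at t (tgt m)) a = fn (onArr (ntgt t) m) b"
    then have ab: "a \<in> onObj (nsrc t) (tgt m)" "b \<in> onObj (ntgt t) (src m)"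
      using tD(5)[OF mD(2)] GD(5)[OF mA] by auto
    from lift[OF m this eq] obtain c where c: "c \<in> onObj (nsrc t) (src m)" "a = fn (onArr (nsrc t) m) c"
      by blast
    then have "fn (onArr (ntgt t) m) (fn (at t (src m)) c) = fn (onArr (ntgt t) m) b"
      using tD(8)[OF mA] eq by simp
    then have "fn (at t (src m)) c = b"
      using inj_onD[OF taut_functor_inj[OF G m]] ab tD(7)[OF mD(1) c(1)] by blast
    with c show "\<exists>c\<in>src (onArr (nsrc t) m). fn (onArr (nsrc t) m) c = a \<and> fn (at t (src m)) c = b"
      using FD(5)[OF mA] by auto
  next
    fix c d assume "c \<in> src (onArr (nsrc t) m)" "d \<in> src (onArr (nsrc t) m)"
      "fn (onArr (nsrc t) m) c = fn (onArr (nsrc t) m) d"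
    then show "c = d" using inj_onD[OF taut_functor_inj[OF F m]] FD(5)[OF mA] by simp
  qed (use tD mD FD GD mA in auto)
qed

text \<open>If \<open>t\<close> sends \<open>a\<close> to the image of \<open>b\<close>, then
  applying \<open>s\<close> exhibits \<open>a\<close> as the image of the value of \<open>s\<close>
  at \<open>b\<close>. This moves isomorphisms found among all functors into the taut
  subcategory.\<close>

lemma inverse_nat_taut:
  assumes "is_nat U t" "is_nat U s" and "nsrc s = ntgt t" "ntgt s = nsrc t"
    and "taut_functor U (nsrc t)" "taut_functor U (ntgt t)"
    and inv: "Comp FUN s t = Idn FUN (nsrc t)"
  shows "taut_nat U t"
proof (rule taut_natI)
  fix m a b assume m: "mono_in SET m" and a: "a \<in> onObj (nsrc t) (tgt m)"
    and b: "b \<in> onObj (ntgt t) (src m)" and eq: "fn (at t (tgt m)) a = fn (onArr (ntgt t) m) b"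
  have mA: "m \<in> Arr SET" using m by (simp add: mono_SET)
  note mD = Arr_SETD(1,2)[OF mA]
  have "a = fn (at s (tgt m)) (fn (at t (tgt m)) a)"
    using at_Comp_FUN[OF assms(1) mD(2) a, of s] a mD by (simp only: inv) simp
  also have "\<dots> = fn (onArr (nsrc t) m) (fn (at s (src m)) b)"
    using is_natD(8)[OF assms(2) mA] b eq assms(3,4) by simp
  finally show "a \<in> fn (onArr (nsrc t) m) ` onObj (nsrc t) (src m)"
    using is_natD(7)[OF assms(2) mD(1)] b assms(3,4) by simp
qed (use assms in auto)

end

section \<open>Tautness of pointwise limits and of their projections\<close>

context diagram
begin

text \<open>Preimages of the components are unique, since every node sends \<open>m\<close> to an
  injection. Transition maps therefore take the chosen preimage at one node to the one at the next,
  and the preimages can be glued.\<close>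

lemma pointwise_limit_image:
  assumes taut: "\<And>i. i \<in> Obj I \<Longrightarrow> taut_functor U (onObj D i)"
    and L: "pointwise_limit L \<pi>" and m: "mono_in SET m" and y: "y \<in> onObj L (tgt m)"
    and im: "\<And>i. i \<in> Obj I \<Longrightarrow>
      fn (at (\<pi> i) (tgt m)) y \<in> fn (onArr (onObj D i) m) ` onObj (onObj D i) (src m)"
  shows "y \<in> fn (onArr L m) ` onObj L (src m)"
proof -
  have c: "is_cone I FUN D L \<pi>" by (rule pointwise_limit_cone[OF L])
  have mA: "m \<in> Arr SET" using m by (simp add: mono_SET)
  note mD = Arr_SETD(1,2)[OF mA]
  have "\<exists>x. x \<in> onObj (onObj D i) (src m) \<and> fn (onArr (onObj D i) m) x = fn (at (\<pi> i) (tgt m)) y"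
    if "i \<in> Obj I" for i
    using im[OF that] by auto
  then obtain x where x: "\<And>i. i \<in> Obj I \<Longrightarrow> x i \<in> onObj (onObj D i) (src m)"
    "\<And>i. i \<in> Obj I \<Longrightarrow> fn (onArr (onObj D i) m) (x i) = fn (at (\<pi> i) (tgt m)) y" by metis
  have "fn (at (onArr D u) (src m)) (x (Dom I u)) = x (Cod I u)" if u: "u \<in> Arr I" for u
  proof -
    let ?i = "Dom I u" and ?j = "Cod I u"
    note ij = ends_in_I[OF u] and t = edge_nat[OF u]
    have xi: "x ?i \<in> onObj (nsrc (onArr D u)) (src m)" using x(1)[OF ij(1)] t by simp
    have "fn (onArr (onObj D ?j) m) (fn (at (onArr D u) (src m)) (x ?i)) =
        fn (at (onArr D u) (tgt m)) (fn (at (\<pi> ?i) (tgt m)) y)"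
      using is_natD(8)[OF t(1) mA xi] t x(2)[OF ij(1)] by simp
    also have "\<dots> = fn (onArr (onObj D ?j) m) (x ?j)"
      using coneD(5)[OF c u mD(2) y] x(2)[OF ij(2)] by simp
    finally show ?thesis
      using inj_onD[OF taut_functor_inj[OF taut[OF ij(2)] m]] x(1)[OF ij(2)]
        is_natD(7)[OF t(1) mD(1) xi] t(3) by simp
  qed
  from pointwise_limit_lift[OF L mD(1) x(1) this]
  obtain z where z: "z \<in> onObj L (src m)" "\<And>i. i \<in> Obj I \<Longrightarrow> fn (at (\<pi> i) (src m)) z = x i"
    by metis
  have "y = fn (onArr L m) z"
  proof (rule pointwise_limit_eqI[OF L mD(2) y])
    show "fn (onArr L m) z \<in> onObj L (tgt m)" using set_functorD(7)[OF coneD(1)[OF c] mA z(1)] .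
    fix i assume i: "i \<in> Obj I"
    show "fn (at (\<pi> i) (tgt m)) y = fn (at (\<pi> i) (tgt m)) (fn (onArr L m) z)"
      using cone_at(2)[OF c i mA z(1)] x(2)[OF i] z(2)[OF i] by simp
  qed
  with z show ?thesis by blast
qed

lemma pointwise_limit_taut:
  assumes taut: "\<And>i. i \<in> Obj I \<Longrightarrow> taut_functor U (onObj D i)"
    and L: "pointwise_limit L \<pi>"
  shows "taut_functor U L"
proof -
  have c: "is_cone I FUN D L \<pi>" by (rule pointwise_limit_cone[OF L])
  note LD = coneD(1)[OF c]
  show ?thesis
  proof (rule taut_functorI[OF LD])
    fix m assume m: "mono_in SET m"
    then have mA: "m \<in> Arr SET" by (simp add: mono_SET)
    note mD = Arr_SETD(1,2)[OF mA]
    show "inj_on (fn (onArr L m)) (onObj L (src m))"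
    proof (rule inj_onI)
      fix z z' assume z: "z \<in> onObj L (src m)" "z' \<in> onObj L (src m)"
        and eq: "fn (onArr L m) z = fn (onArr L m) z'"
      show "z = z'"
      proof (rule pointwise_limit_eqI[OF L mD(1) z])
        fix i assume i: "i \<in> Obj I"
        show "fn (at (\<pi> i) (src m)) z = fn (at (\<pi> i) (src m)) z'"
          using inj_onD[OF taut_functor_inj[OF taut[OF i] m]] cone_at(1)[OF c i mD(1)]
            cone_at(2)[OF c i mA] z eq by metis
      qed
    qed
  next
    fix p q f m a b
    assume pb: "is_pullback SET p q f m" and m: "mono_in SET m"
      and a: "a \<in> onObj L (src f)" and b: "b \<in> onObj L (src m)"
      and eq: "fn (onArr L f) a = fn (onArr L m) b"
    note pD = is_pullbackD[OF pb]
    \<comment> \<open>The image criterion is applied to \<open>p\<close>, monic as a pullback of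
      \<open>m\<close>; each component of \<open>a\<close> lifts along it by tautness of the
      node.\<close>
    show "a \<in> fn (onArr L p) ` onObj L (src p)"
    proof (rule pointwise_limit_image[OF taut L mono_pullback[OF pb m]])
      show "a \<in> onObj L (tgt p)" using a pD by simp
      fix i assume i: "i \<in> Obj I"
      have "fn (onArr (onObj D i) f) (fn (at (\<pi> i) (src f)) a) =
          fn (onArr (onObj D i) m) (fn (at (\<pi> i) (src m)) b)"
        using cone_at(2)[OF c i pD(3) a] cone_at(2)[OF c i pD(4) b] eq pD(8) by simp
      then show "fn (at (\<pi> i) (tgt p)) a \<in> fn (onArr (onObj D i) p) ` onObj (onObj D i) (src p)"
        using taut_functor_lift[OF taut[OF i] pb m] cone_at(1)[OF c i] a b pD Arr_SETD(1) by metis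
    qed
  qed
qed

text \<open>Membership in the image of a monomorphism is transported along an arrow of the diagram in both
  directions: forwards by naturality, backwards by tautness. Connectedness spreads it to all nodes.\<close>

lemma pointwise_limit_projection_taut:
  assumes conn: "connected_category I"
    and taut: "\<And>i. i \<in> Obj I \<Longrightarrow> taut_functor U (onObj D i)"
    and taut_edge: "\<And>u. u \<in> Arr I \<Longrightarrow> taut_nat U (onArr D u)"
    and L: "pointwise_limit L \<pi>" and i: "i \<in> Obj I"
  shows "taut_nat U (\<pi> i)"
proof -
  have c: "is_cone I FUN D L \<pi>" by (rule pointwise_limit_cone[OF L])
  note pi = coneD(2-4)[OF c]
  have LT: "taut_functor U L" by (rule pointwise_limit_taut[OF taut L])
  show ?thesis
  proof (rule taut_natI[OF pi(1)[OF i]])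
    fix m a b
    assume m: "mono_in SET m" and "a \<in> onObj (nsrc (\<pi> i)) (tgt m)"
      and "b \<in> onObj (ntgt (\<pi> i)) (src m)"
      and eq: "fn (at (\<pi> i) (tgt m)) a = fn (onArr (ntgt (\<pi> i)) m) b"
    then have a: "a \<in> onObj L (tgt m)" and b: "b \<in> onObj (onObj D i) (src m)" using pi[OF i] by auto
    have mA: "m \<in> Arr SET" using m by (simp add: mono_SET)
    note mD = Arr_SETD(1,2)[OF mA]
    define P where "P j \<longleftrightarrow>
      fn (at (\<pi> j) (tgt m)) a \<in> fn (onArr (onObj D j) m) ` onObj (onObj D j) (src m)" for j
    have edge: "P (Dom I u) \<longleftrightarrow> P (Cod I u)" if u: "u \<in> Arr I" for u
    proof -
      let ?j = "Dom I u" and ?k = "Cod I u" and ?t = "onArr D u"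
      note jk = ends_in_I[OF u] and t = edge_nat[OF u]
      have tr: "fn (at ?t (tgt m)) (fn (at (\<pi> ?j) (tgt m)) a) = fn (at (\<pi> ?k) (tgt m)) a"
        by (rule coneD(5)[OF c u mD(2) a])
      show ?thesis
      proof
        assume "P ?j"
        then obtain x where x: "x \<in> onObj (onObj D ?j) (src m)"
          "fn (at (\<pi> ?j) (tgt m)) a = fn (onArr (onObj D ?j) m) x" unfolding P_def by blast
        then have "fn (at (\<pi> ?k) (tgt m)) a = fn (onArr (onObj D ?k) m) (fn (at ?t (src m)) x)"
          using tr is_natD(8)[OF t(1) mA] t by simp
        then show "P ?k" using is_natD(7)[OF t(1) mD(1)] t x unfolding P_def by simp
      next
        assume "P ?k"
        then obtain x where "x \<in> onObj (onObj D ?k) (src m)"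
          "fn (at (\<pi> ?k) (tgt m)) a = fn (onArr (onObj D ?k) m) x" unfolding P_def by blast
        then show "P ?j"
          using taut_nat_lift[OF taut_edge[OF u] m, of "fn (at (\<pi> ?j) (tgt m)) a" x] tr t
            cone_at(1)[OF c jk(1) mD(2) a] unfolding P_def by simp
      qed
    qed
    \<comment> \<open>Start of the propagation: the premise of the lifting property says that
      \<open>b\<close> is a preimage at node \<open>i\<close>.\<close>
    have "P i" using eq b pi[OF i] unfolding P_def by simp
    have "P j" if "j \<in> Obj I" for j
    proof -
      have "(i, j) \<in> ((\<lambda>f. (Dom I f, Cod I f)) ` Arr I \<union> (\<lambda>f. (Cod I f, Dom I f)) ` Arr I)\<^sup>*"
        using conn i that by (simp add: connected_category_def)
      then show ?thesis by induction (use \<open>P i\<close> edge in auto)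
    qed
    then have "a \<in> fn (onArr L m) ` onObj L (src m)"
      unfolding P_def using pointwise_limit_image[OF taut L m a] by blast
    then show "a \<in> fn (onArr (nsrc (\<pi> i)) m) ` onObj (nsrc (\<pi> i)) (src m)"
      using pi[OF i] by simp
  qed (use pi[OF i] LT taut[OF i] in simp_all)
qed

end

section \<open>The difference functor\<close>

context universe
begin

text \<open>\<open>plus_one_code\<close> is a choice, so a suitable pair must exist: an infinite
  type is in bijection with itself minus one point. The point removed, \<open>undefined\<close>, is
  arbitrary.\<close>

lemma inl_pt: "inj (inl :: 'u \<Rightarrow> 'u)" "(pt :: 'u) \<notin> range inl"
proof -
  have "infinite (UNIV :: 'u set)" using set_universe by (simp add: set_universe_def)
  then obtain h :: "'u \<Rightarrow> 'u" where "bij_betw h UNIV (UNIV - {undefined})"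
    by (blast dest: infinite_imp_bij_betw)
  then have "\<exists>c :: ('u \<Rightarrow> 'u) \<times> 'u. inj (fst c) \<and> snd c \<notin> range (fst c)"
    by (intro exI[of _ "(h, undefined)"]) (auto simp: bij_betw_def)
  from someI_ex[OF this]
  show "inj (inl :: 'u \<Rightarrow> 'u)" "(pt :: 'u) \<notin> range inl"
    unfolding inl_def pt_def plus_one_code_def by blast+
qed

lemma inl_simps [simp]: "inl x = inl y \<longleftrightarrow> x = y" "inl x \<noteq> pt" "pt \<noteq> inl x" for x y :: 'u
  using inl_pt by (metis injD, metis rangeI, metis rangeI)

lemma plus_one_in_U: "X \<in> U \<Longrightarrow> plus_one X \<in> U"
  by (simp add: plus_one_def insert_in_U image_in_U)

lemma plus_one_cases:
  assumes "z \<in> plus_one X"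
  obtains "z = pt" | x where "x \<in> X" "z = inl x"
  using assms by (auto simp: plus_one_def)

lemma pt_in_plus_one [simp]: "pt \<in> plus_one X" and inl_in_plus_one [simp]: "inl x \<in> plus_one X \<longleftrightarrow> x \<in> X"
  for X :: "'u set"
  by (auto simp: plus_one_def)

lemma plus_one_arr_simps [simp]:
  "src (plus_one_arr f) = plus_one (src f)" "tgt (plus_one_arr f) = plus_one (tgt f)"
  "fn (plus_one_arr f) pt = pt" "x \<in> src f \<Longrightarrow> fn (plus_one_arr f) (inl x) = inl (fn f x)"
  for f :: "'u set_arr"
  using inl_pt(1) by (simp_all add: plus_one_arr_def the_inv_f_f)

lemma plus_one_arr_in_Arr:
  assumes f: "f \<in> Arr SET"
  shows "plus_one_arr f \<in> Arr SET"
proof -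
  have "fn (plus_one_arr f) z \<in> plus_one (tgt f)" if "z \<in> plus_one (src f)" for z
    using that by (rule plus_one_cases) (use Arr_SETD[OF f] in auto)
  moreover have "fn (plus_one_arr f) \<in> extensional (plus_one (src f))" by (simp add: plus_one_arr_def)
  ultimately show ?thesis
    using f by (auto simp: Arr_SET_iff plus_one_in_U PiE_iff)
qed

lemma plus_one_arr_Idn:
  assumes X: "X \<in> U"
  shows "plus_one_arr (Idn SET X) = Idn SET (plus_one X)"
proof (rule set_arr_eqI)
  show "plus_one_arr (Idn SET X) \<in> Arr SET" by (intro plus_one_arr_in_Arr Arr_SET_Idn X)
  show "Idn SET (plus_one X) \<in> Arr SET" by (intro plus_one_in_U Arr_SET_Idn X)
  fix z assume "z \<in> src (plus_one_arr (Idn SET X))"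
  then have "z \<in> plus_one X" by simp
  then show "fn (plus_one_arr (Idn SET X)) z = fn (Idn SET (plus_one X)) z"
    by (cases rule: plus_one_cases) auto
qed simp_all

lemma plus_one_arr_Comp:
  assumes f: "f \<in> Arr SET" and g: "g \<in> Arr SET" and fg: "tgt f = src g"
  shows "plus_one_arr (Comp SET g f) = Comp SET (plus_one_arr g) (plus_one_arr f)"
proof (rule set_arr_eqI)
  show "plus_one_arr (Comp SET g f) \<in> Arr SET"
    by (intro plus_one_arr_in_Arr Arr_SET_Comp f g fg)
  show "Comp SET (plus_one_arr g) (plus_one_arr f) \<in> Arr SET"
    by (intro plus_one_arr_in_Arr Arr_SET_Comp f g) (simp add: fg)
  fix z assume "z \<in> src (plus_one_arr (Comp SET g f))"
  then have "z \<in> plus_one (src f)" by simp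
  then show "fn (plus_one_arr (Comp SET g f)) z = fn (Comp SET (plus_one_arr g) (plus_one_arr f)) z"
    by (rule plus_one_cases) (use Arr_SETD(3)[OF f] fg in auto)
qed simp_all

lemma coprod_inj_simps [simp]:
  "src (coprod_inj X) = X" "tgt (coprod_inj X) = plus_one X" "x \<in> X \<Longrightarrow> fn (coprod_inj X) x = inl x"
  by (simp_all add: coprod_inj_def)

lemma coprod_inj_mono: "X \<in> U \<Longrightarrow> mono_in SET (coprod_inj X)"
  unfolding mono_SET
  by (auto simp: coprod_inj_def Arr_SET_iff plus_one_in_U intro: inj_onI)

lemma coprod_inj_in_Arr: "X \<in> U \<Longrightarrow> coprod_inj X \<in> Arr SET"
  using coprod_inj_mono by (simp add: mono_SET)

text \<open>\<open>plus_one_arr f\<close> fixes the added point, so the inverse image of the old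
  part of the target is exactly the old part of the source. Preservation of this square is what
  makes the difference of a taut functor act on arrows.\<close>

lemma coprod_inj_pullback:
  assumes f: "f \<in> Arr SET"
  shows "is_pullback SET (coprod_inj (src f)) f (plus_one_arr f) (coprod_inj (tgt f))"
proof (rule is_pullbackI)
  fix a b assume "a \<in> src (plus_one_arr f)" "b \<in> src (coprod_inj (tgt f))"
    and eq: "fn (plus_one_arr f) a = fn (coprod_inj (tgt f)) b"
  then have "a \<in> plus_one (src f)" and b: "b \<in> tgt f" by simp_all
  then show "\<exists>c\<in>src (coprod_inj (src f)). fn (coprod_inj (src f)) c = a \<and> fn f c = b"
    by (cases rule: plus_one_cases) (use eq b in auto)
qed (use f in \<open>auto simp: Arr_SETD coprod_inj_in_Arr plus_one_arr_in_Arr\<close>)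

text \<open>Over the added point lies only the added point, and elsewhere the square is the given
  one. With \<open>plus_one_mono\<close>, adding a point preserves inverse image squares, so
  tautness of F can be used at these enlarged squares.\<close>

lemma plus_one_pullback:
  assumes pb: "is_pullback SET p q f m"
  shows "is_pullback SET (plus_one_arr p) (plus_one_arr q) (plus_one_arr f) (plus_one_arr m)"
proof -
  note D = is_pullbackD[OF pb]
  have pq: "fn p c \<in> src f" "fn q c \<in> src m" if "c \<in> src p" for c
    using that Arr_SETD(3)[OF D(1)] Arr_SETD(3)[OF D(2)] D by simp_all
  show ?thesis
  proof (rule is_pullbackI)
    fix c assume "c \<in> src (plus_one_arr p)"
    then have "c \<in> plus_one (src p)" by simp
    then show "fn (plus_one_arr f) (fn (plus_one_arr p) c) = fn (plus_one_arr m) (fn (plus_one_arr q) c)"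
      by (cases rule: plus_one_cases) (use D pq in auto)
  next
    fix a b assume "a \<in> src (plus_one_arr f)" "b \<in> src (plus_one_arr m)"
      and eq: "fn (plus_one_arr f) a = fn (plus_one_arr m) b"
    then have a: "a \<in> plus_one (src f)" and b: "b \<in> plus_one (src m)" by simp_all
    from a show "\<exists>c\<in>src (plus_one_arr p). fn (plus_one_arr p) c = a \<and> fn (plus_one_arr q) c = b"
    proof (cases rule: plus_one_cases)
      case 1
      with b eq have "b = pt" by (cases rule: plus_one_cases) auto
      with 1 show ?thesis by (intro bexI[of _ pt]) auto
    next
      case (2 a')
      \<comment> \<open>The value at \<open>inl a'\<close> differs from \<open>pt\<close>, which
        rules out \<open>b = pt\<close>; the underlying elements then meet in the original
        square.\<close>
      with b eq obtain b' where b': "b' \<in> src m" "b = inl b'" "fn f a' = fn m b'"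
        by (cases rule: plus_one_cases) auto
      with 2 obtain c where "c \<in> src p" "fn p c = a'" "fn q c = b'"
        using is_pullback_lift[OF pb] by metis
      with 2 b' D(5) show ?thesis by (intro bexI[of _ "inl c"]) auto
    qed
  next
    fix c d assume "c \<in> src (plus_one_arr p)" "d \<in> src (plus_one_arr p)"
      and eq: "fn (plus_one_arr p) c = fn (plus_one_arr p) d" "fn (plus_one_arr q) c = fn (plus_one_arr q) d"
    then have c: "c \<in> plus_one (src p)" and d: "d \<in> plus_one (src p)" by simp_all
    from c show "c = d"
    proof (cases rule: plus_one_cases)
      case 1
      from d show ?thesis by (cases rule: plus_one_cases) (use 1 eq in auto)
    next
      case (2 c')
      from d show ?thesis
      proof (cases rule: plus_one_cases)
        case (2 d')
        with \<open>c' \<in> src p\<close> \<open>c = inl c'\<close> eq D(5) is_pullback_unique[OF pb, of c' d'] show ?thesis by simp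
      qed (use 2 eq in auto)
    qed
  qed (use D in \<open>auto simp: plus_one_arr_in_Arr\<close>)
qed

lemma plus_one_mono:
  assumes m: "mono_in SET m"
  shows "mono_in SET (plus_one_arr m)"
proof -
  have "m \<in> Arr SET" and inj: "inj_on (fn m) (src m)" using m by (auto simp: mono_SET)
  moreover have "inj_on (fn (plus_one_arr m)) (plus_one (src m))"
  proof (rule inj_onI)
    fix y z assume y: "y \<in> plus_one (src m)" and z: "z \<in> plus_one (src m)"
      and eq: "fn (plus_one_arr m) y = fn (plus_one_arr m) z"
    from y show "y = z"
    proof (cases rule: plus_one_cases)
      case 1
      from z show ?thesis by (cases rule: plus_one_cases) (use 1 eq in auto)
    next
      case (2 y')
      from z show ?thesis by (cases rule: plus_one_cases) (use 2 eq inj in \<open>auto dest: inj_onD\<close>)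
    qed
  qed
  ultimately show ?thesis by (simp add: mono_SET plus_one_arr_in_Arr)
qed

section \<open>Differences of taut functors and taut transformations\<close>

lemma diff_fctr_simps [simp]:
  "X \<in> U \<Longrightarrow> onObj (diff_fctr U F) X = diff_set F X"
  "f \<in> Arr SET \<Longrightarrow> y \<in> diff_set F (src f) \<Longrightarrow>
    fn (onArr (diff_fctr U F) f) y = fn (onArr F (plus_one_arr f)) y"
  by (simp_all add: diff_fctr_def)

lemma diff_nat_simps [simp]:
  "nsrc (diff_nat U t) = diff_fctr U (nsrc t)" "ntgt (diff_nat U t) = diff_fctr U (ntgt t)"
  "X \<in> U \<Longrightarrow> y \<in> diff_set (nsrc t) X \<Longrightarrow> fn (at (diff_nat U t) X) y = fn (at t (plus_one X)) y"
  by (simp_all add: diff_nat_def)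

text \<open>If the value came from \<open>onObj F (tgt f)\<close>, the preserved square
  \<open>coprod_inj_pullback\<close> would bring \<open>y\<close> itself from
  \<open>onObj F (src f)\<close>.\<close>

lemma diff_set_map:
  assumes F: "taut_functor U F" and f: "f \<in> Arr SET" and y: "y \<in> diff_set F (src f)"
  shows "fn (onArr F (plus_one_arr f)) y \<in> diff_set F (tgt f)"
proof -
  have y': "y \<in> onObj F (src (plus_one_arr f))" using y by (simp add: diff_set_def)
  have "fn (onArr F (plus_one_arr f)) y \<in> onObj F (plus_one (tgt f))"
    using set_functorD(7)[OF taut_set_functor[OF F] plus_one_arr_in_Arr[OF f] y'] by simp
  moreover have "fn (onArr F (plus_one_arr f)) y \<noteq> fn (onArr F (coprod_inj (tgt f))) b"
    if "b \<in> onObj F (tgt f)" for b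
    using taut_functor_lift[OF F coprod_inj_pullback[OF f] coprod_inj_mono y', of b] that y f
    by (auto simp: diff_set_def Arr_SETD)
  ultimately show ?thesis by (auto simp: diff_set_def)
qed

text \<open>An element of the image of \<open>coprod_inj\<close> stays in such an image, because the
  square of \<open>coprod_inj_pullback\<close> commutes. This places lifts found in all of
  \<open>onObj F (plus_one (src f))\<close> into the complement.\<close>

lemma diff_set_reflect:
  assumes F: "taut_functor U F" and f: "f \<in> Arr SET" and c: "c \<in> onObj F (plus_one (src f))"
    and y: "fn (onArr F (plus_one_arr f)) c \<in> diff_set F (tgt f)"
  shows "c \<in> diff_set F (src f)"
proof -
  have "c \<noteq> fn (onArr F (coprod_inj (src f))) d" if d: "d \<in> onObj F (src f)" for d
  proof
    assume "c = fn (onArr F (coprod_inj (src f))) d"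
    then have "fn (onArr F (plus_one_arr f)) c = fn (onArr F (coprod_inj (tgt f))) (fn (onArr F f) d)"
      using set_functor_square[OF taut_set_functor[OF F] coprod_inj_pullback[OF f]] d by simp
    with y set_functorD(7)[OF taut_set_functor[OF F] f d] show False by (auto simp: diff_set_def)
  qed
  with c show ?thesis by (auto simp: diff_set_def)
qed

lemma diff_fctr_set_functor:
  assumes F: "taut_functor U F"
  shows "set_functor (diff_fctr U F)"
  using diff_fctr_def
proof (rule set_functorI)
  note FD = set_functorD[OF taut_set_functor[OF F]]
  have mem: "y \<in> onObj F (plus_one X)" if "y \<in> diff_set F X" for y X
    using that by (simp add: diff_set_def)
  show "diff_set F X \<in> U" if "X \<in> U" for X
    using FD(3)[OF plus_one_in_U[OF that]] by (rule subset_in_U) (auto simp: diff_set_def)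
  show "fn (onArr F (plus_one_arr f)) y \<in> diff_set F (tgt f)"
    if "f \<in> Arr SET" "y \<in> diff_set F (src f)" for f y
    using diff_set_map[OF F that] .
  show "fn (onArr F (plus_one_arr (Idn SET X))) y = y" if "X \<in> U" "y \<in> diff_set F X" for X y
    using FD(8)[OF plus_one_in_U[OF that(1)] mem[OF that(2)]] plus_one_arr_Idn[OF that(1)] by metis
  show "fn (onArr F (plus_one_arr (Comp SET g f))) y =
      fn (onArr F (plus_one_arr g)) (fn (onArr F (plus_one_arr f)) y)"
    if "f \<in> Arr SET" "g \<in> Arr SET" "tgt f = src g" "y \<in> diff_set F (src f)" for f g y
    using FD(9)[OF plus_one_arr_in_Arr[OF that(1)] plus_one_arr_in_Arr[OF that(2)], of y]
      plus_one_arr_Comp[OF that(1-3)] that mem by simp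
qed

text \<open>Tautness of F at the enlarged square gives a lift of \<open>a\<close> that could a
  priori lie in the image of \<open>coprod_inj\<close>; \<open>diff_set_reflect\<close> excludes
  this, as \<open>a\<close> lies in the complement.\<close>

lemma diff_fctr_taut:
  assumes F: "taut_functor U F"
  shows "taut_functor U (diff_fctr U F)"
proof (rule taut_functorI[OF diff_fctr_set_functor[OF F]])
  fix m assume m: "mono_in SET m"
  then have mA: "m \<in> Arr SET" by (simp add: mono_SET)
  have "inj_on (fn (onArr F (plus_one_arr m))) (diff_set F (src m))"
    using taut_functor_inj[OF F plus_one_mono[OF m]] by (rule inj_on_subset) (auto simp: diff_set_def)
  then show "inj_on (fn (onArr (diff_fctr U F) m)) (onObj (diff_fctr U F) (src m))"
    using mA by (simp add: Arr_SETD inj_on_def)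
next
  fix p q f m a b
  assume pb: "is_pullback SET p q f m" and m: "mono_in SET m"
    and "a \<in> onObj (diff_fctr U F) (src f)" "b \<in> onObj (diff_fctr U F) (src m)"
    and "fn (onArr (diff_fctr U F) f) a = fn (onArr (diff_fctr U F) m) b"
  note D = is_pullbackD[OF pb]
  from \<open>a \<in> _\<close> \<open>b \<in> _\<close> have a: "a \<in> diff_set F (src f)" and b: "b \<in> diff_set F (src m)"
    using D by (simp_all add: Arr_SETD)
  then have eq: "fn (onArr F (plus_one_arr f)) a = fn (onArr F (plus_one_arr m)) b"
    using \<open>fn _ a = fn _ b\<close> D by simp
  have "a \<in> fn (onArr F (plus_one_arr p)) ` onObj F (src (plus_one_arr p))"
    using a b eq
    by (intro taut_functor_lift[OF F plus_one_pullback[OF pb] plus_one_mono[OF m], of a b])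
       (simp_all add: diff_set_def)
  then obtain c where c: "c \<in> onObj F (plus_one (src p))" "a = fn (onArr F (plus_one_arr p)) c" by auto
  have "c \<in> diff_set F (src p)"
    using diff_set_reflect[OF F D(1) c(1)] a c(2) D(6) by simp
  with c show "a \<in> fn (onArr (diff_fctr U F) p) ` onObj (diff_fctr U F) (src p)"
    using D by (intro image_eqI[of _ _ c]) (auto simp: Arr_SETD)
qed

text \<open>Tautness of \<open>t\<close> at the monomorphism \<open>coprod_inj X\<close>: what
  \<open>t\<close> sends into the image was in the image already.\<close>

lemma diff_set_nat:
  assumes t: "taut_nat U t" and X: "X \<in> U" and y: "y \<in> diff_set (nsrc t) X"
  shows "fn (at t (plus_one X)) y \<in> diff_set (ntgt t) X"
proof -
  have "fn (at t (plus_one X)) y \<noteq> fn (onArr (ntgt t) (coprod_inj X)) b"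
    if "b \<in> onObj (ntgt t) X" for b
    using taut_nat_lift[OF t coprod_inj_mono[OF X], of y b] that y by (auto simp: diff_set_def)
  moreover have "fn (at t (plus_one X)) y \<in> onObj (ntgt t) (plus_one X)"
    using is_natD(7)[OF taut_nat_is_nat[OF t] plus_one_in_U[OF X]] y by (simp add: diff_set_def)
  ultimately show ?thesis by (auto simp: diff_set_def)
qed

lemma diff_nat_is_nat:
  assumes "t \<in> Arr TAUT"
  shows "is_nat U (diff_nat U t)"
proof -
  have t: "taut_nat U t" and F: "taut_functor U (nsrc t)" and G: "taut_functor U (ntgt t)"
    using assms by auto
  show ?thesis
  proof (rule is_natI)
    \<comment> \<open>The object parts of the difference functors replace \<open>diff_set\<close>,
      with which they agree on \<open>U\<close>, to reach the shape required by
      \<open>is_natI\<close>.\<close>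
    show "diff_nat U t = NatArr (diff_fctr U (nsrc t))
        (\<lambda>X\<in>U. SetArr (onObj (diff_fctr U (nsrc t)) X)
          (restrict (fn (at t (plus_one X))) (onObj (diff_fctr U (nsrc t)) X))
          (onObj (diff_fctr U (ntgt t)) X)) (diff_fctr U (ntgt t))"
      by (auto simp: diff_nat_def)
    fix f y assume f: "f \<in> Arr SET" and "y \<in> onObj (diff_fctr U (nsrc t)) (src f)"
    then have y: "y \<in> diff_set (nsrc t) (src f)" by (simp add: Arr_SETD)
    then have "fn (at t (plus_one (tgt f))) (fn (onArr (nsrc t) (plus_one_arr f)) y) =
        fn (onArr (ntgt t) (plus_one_arr f)) (fn (at t (plus_one (src f))) y)"
      using is_natD(8)[OF taut_nat_is_nat[OF t] plus_one_arr_in_Arr[OF f], of y]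
      by (simp add: diff_set_def)
    then show "fn (at t (plus_one (tgt f))) (fn (onArr (diff_fctr U (nsrc t)) f) y) =
        fn (onArr (diff_fctr U (ntgt t)) f) (fn (at t (plus_one (src f))) y)"
      using f y diff_set_nat[OF t] by (simp add: Arr_SETD)
  qed (use F G diff_set_nat[OF t] in \<open>auto intro: diff_fctr_set_functor\<close>)
qed

text \<open>The same pattern as for functors: a lift is found by tautness of \<open>t\<close> at
  \<open>plus_one_arr m\<close>, and \<open>diff_set_reflect\<close> moves it into the
  complement.\<close>

lemma diff_nat_in_Arr:
  assumes "t \<in> Arr TAUT"
  shows "diff_nat U t \<in> Arr TAUT"
proof -
  have t: "taut_nat U t" and F: "taut_functor U (nsrc t)" and G: "taut_functor U (ntgt t)"
    using assms by auto
  have "taut_nat U (diff_nat U t)"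
  proof (rule taut_natI[OF diff_nat_is_nat[OF assms]])
    fix m a b
    assume m: "mono_in SET m" and "a \<in> onObj (nsrc (diff_nat U t)) (tgt m)"
      "b \<in> onObj (ntgt (diff_nat U t)) (src m)"
      "fn (at (diff_nat U t) (tgt m)) a = fn (onArr (ntgt (diff_nat U t)) m) b"
    have mA: "m \<in> Arr SET" using m by (simp add: mono_SET)
    note mD = Arr_SETD(1,2)[OF mA]
    have a: "a \<in> diff_set (nsrc t) (tgt m)" and b: "b \<in> diff_set (ntgt t) (src m)"
      using \<open>a \<in> _\<close> \<open>b \<in> _\<close> mD by simp_all
    then have "fn (at t (plus_one (tgt m))) a = fn (onArr (ntgt t) (plus_one_arr m)) b"
      using \<open>fn _ a = fn _ b\<close> mD mA by simp
    then obtain c where c: "c \<in> onObj (nsrc t) (plus_one (src m))" "a = fn (onArr (nsrc t) (plus_one_arr m)) c"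
      using taut_nat_lift[OF t plus_one_mono[OF m], of a b] a b by (auto simp: diff_set_def)
    then have "c \<in> diff_set (nsrc t) (src m)"
      using diff_set_reflect[OF F mA] a by simp
    with c mA mD show "a \<in> fn (onArr (nsrc (diff_nat U t)) m) ` onObj (nsrc (diff_nat U t)) (src m)"
      by (intro image_eqI[of _ _ c]) auto
  qed (use F G in \<open>auto intro: diff_fctr_taut\<close>)
  with F G show ?thesis by (simp add: diff_fctr_taut)
qed

text \<open>That the identity, and below the composite, is an arrow of \<open>TAUT\<close> is a
  premise: where these laws are applied, both are values of \<open>\<Gamma>\<close> and thus
  taut.\<close>

lemma diff_nat_Idn:
  assumes F: "taut_functor U F" and idn: "Idn FUN F \<in> Arr TAUT"
  shows "diff_nat U (Idn FUN F) = Idn FUN (diff_fctr U F)"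
proof (rule nat_eqI)
  show "is_nat U (diff_nat U (Idn FUN F))" by (rule diff_nat_is_nat[OF idn])
  show "is_nat U (Idn FUN (diff_fctr U F))" by (rule is_nat_Idn[OF diff_fctr_set_functor[OF F]])
qed (auto simp: plus_one_in_U diff_set_def)

lemma diff_nat_Comp:
  assumes s: "s \<in> Arr TAUT" and t: "t \<in> Arr TAUT" and st: "Comp FUN s t \<in> Arr TAUT"
    and eq: "ntgt t = nsrc s"
  shows "diff_nat U (Comp FUN s t) = Comp FUN (diff_nat U s) (diff_nat U t)"
proof (rule nat_eqI)
  show "is_nat U (diff_nat U (Comp FUN s t))" by (rule diff_nat_is_nat[OF st])
  show "is_nat U (Comp FUN (diff_nat U s) (diff_nat U t))"
    by (intro is_nat_Comp diff_nat_is_nat s t) (simp add: eq)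
next
  fix X y assume X: "X \<in> U" and "y \<in> onObj (nsrc (diff_nat U (Comp FUN s t))) X"
  then have y: "y \<in> diff_set (nsrc t) X" by simp
  have ty: "fn (at t (plus_one X)) y \<in> diff_set (nsrc s) X"
    using diff_set_nat[of t X y] t X y eq by simp
  have "fn (at (diff_nat U (Comp FUN s t)) X) y = fn (at (Comp FUN s t) (plus_one X)) y"
    using X y by simp
  also have "\<dots> = fn (at s (plus_one X)) (fn (at t (plus_one X)) y)"
    using t y X by (intro at_Comp_FUN) (auto simp: taut_nat_is_nat plus_one_in_U diff_set_def)
  also have "\<dots> = fn (at (Comp FUN (diff_nat U s) (diff_nat U t)) X) y"
    using at_Comp_FUN[OF diff_nat_is_nat[OF t] X, of y "diff_nat U s"] X y ty by simp
  finally show "fn (at (diff_nat U (Comp FUN s t)) X) y = fn (at (Comp FUN (diff_nat U s) (diff_nat U t)) X) y" .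
qed simp_all

end

section \<open>A diagram of taut functors and the diagram of its differences\<close>

locale taut_diagram = universe U S for U S :: "'u set set" +
  fixes I :: "('i, 'k) cat" and \<Gamma> :: "('i, 'k, 'u set_fctr, 'u nat_arr) fctr"
  assumes I_category: "is_category I" and \<Gamma>: "is_functor I (taut_cat U) \<Gamma>"
begin

abbreviation \<Delta>\<Gamma> where "\<Delta>\<Gamma> \<equiv> fctr_comp I (Diff U) \<Gamma>"

lemma node_taut: "i \<in> Obj I \<Longrightarrow> taut_functor U (onObj \<Gamma> i)"
  using \<Gamma> by (auto simp: is_functor_def[of I])

lemma edge_in_Arr: "u \<in> Arr I \<Longrightarrow> onArr \<Gamma> u \<in> Arr TAUT"
  using \<Gamma> by (auto simp: is_functor_def[of I] hom_def)

text \<open>\<open>TAUT\<close> has the domains, codomains, identities and composition of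
  \<open>FUN\<close>, with objects and arrows cut down, so a diagram of taut functors may be read
  among all functors, where limits are formed.\<close>

lemma taut_functor_imp_functor: "is_functor I TAUT E \<Longrightarrow> is_functor I FUN E"
  by (auto simp: is_functor_def[of I] hom_def taut_set_functor taut_nat_is_nat)

sublocale G: diagram U S I \<Gamma>
  by unfold_locales (use I_category taut_functor_imp_functor[OF \<Gamma>] in auto)

lemma onObj_diff: "i \<in> Obj I \<Longrightarrow> onObj \<Delta>\<Gamma> i = diff_fctr U (onObj \<Gamma> i)"
  using node_taut by (simp add: fctr_comp_def Diff_def)

lemma onArr_diff: "u \<in> Arr I \<Longrightarrow> onArr \<Delta>\<Gamma> u = diff_nat U (onArr \<Gamma> u)"
  using edge_in_Arr by (simp add: fctr_comp_def Diff_def)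

lemma diff_diagram_functor: "is_functor I TAUT \<Delta>\<Gamma>"
  unfolding is_functor_def
proof (intro conjI ballI impI)
  fix i assume i: "i \<in> Obj I"
  then show "onObj \<Delta>\<Gamma> i \<in> Obj TAUT" by (simp add: onObj_diff diff_fctr_taut node_taut)
  have idn: "Idn I i \<in> Arr I" using I_category i by (auto simp: is_category_def hom_def)
  have eq: "onArr \<Gamma> (Idn I i) = Idn FUN (onObj \<Gamma> i)" using \<Gamma> i by (simp add: is_functor_def[of I])
  show "onArr \<Delta>\<Gamma> (Idn I i) = Idn TAUT (onObj \<Delta>\<Gamma> i)"
    using diff_nat_Idn[OF node_taut[OF i]] edge_in_Arr[OF idn] onArr_diff[OF idn] onObj_diff[OF i] eq
    by (simp only: taut_cat_simps)
next
  fix u assume u: "u \<in> Arr I"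
  then show "onArr \<Delta>\<Gamma> u \<in> hom TAUT (onObj \<Delta>\<Gamma> (Dom I u)) (onObj \<Delta>\<Gamma> (Cod I u))"
    using diff_nat_in_Arr[OF edge_in_Arr[OF u]] G.edge_nat[OF u] G.ends_in_I[OF u]
    by (simp add: hom_def onArr_diff onObj_diff)
next
  fix u v assume u: "u \<in> Arr I" and v: "v \<in> Arr I" and uv: "Cod I u = Dom I v"
  then have vu: "Comp I v u \<in> Arr I" using I_category by (auto simp: is_category_def hom_def)
  have eq: "onArr \<Gamma> (Comp I v u) = Comp FUN (onArr \<Gamma> v) (onArr \<Gamma> u)"
    using \<Gamma> u v uv by (simp add: is_functor_def[of I])
  have "ntgt (onArr \<Gamma> u) = nsrc (onArr \<Gamma> v)" using G.edge_nat[OF u] G.edge_nat[OF v] uv by simp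
  then show "onArr \<Delta>\<Gamma> (Comp I v u) = Comp TAUT (onArr \<Delta>\<Gamma> v) (onArr \<Delta>\<Gamma> u)"
    using diff_nat_Comp[OF edge_in_Arr[OF v] edge_in_Arr[OF u]] edge_in_Arr[OF vu]
      onArr_diff[OF u] onArr_diff[OF v] onArr_diff[OF vu] eq
    by (simp only: taut_cat_simps)
qed (simp_all add: fctr_comp_def)

text \<open>A second instance of the theory of diagrams, at the composite with
  \<open>Diff U\<close>: families and pointwise limits of both sides are now available under the
  prefixes \<open>G\<close> and \<open>DG\<close>.\<close>

sublocale DG: diagram U S I \<Delta>\<Gamma>
  by unfold_locales (use I_category taut_functor_imp_functor[OF diff_diagram_functor] in auto)

text \<open>Connectedness enters through tautness of the projections: it keeps the components of an
  element of \<open>diff_set L X\<close> outside the images, so that the restricted projections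
  exist. Nonemptiness enters in the opposite direction, when a glued element must be shown to lie
  outside the image.\<close>

lemma diff_pointwise_limit:
  assumes ne: "nonempty_category I" and conn: "connected_category I" and L: "G.pointwise_limit L \<pi>"
  shows "DG.pointwise_limit (diff_fctr U L) (\<lambda>i. diff_nat U (\<pi> i))"
proof -
  have c: "is_cone I FUN \<Gamma> L \<pi>" by (rule G.pointwise_limit_cone[OF L])
  note pi = G.coneD(2-4)[OF c]
  have LT: "taut_functor U L" using G.pointwise_limit_taut[OF node_taut L] .
  have piT: "taut_nat U (\<pi> i)" if "i \<in> Obj I" for i
    using G.pointwise_limit_projection_taut[OF conn node_taut _ L that] edge_in_Arr by simp
  have piA: "\<pi> i \<in> Arr TAUT" if "i \<in> Obj I" for i
    using piT[OF that] LT node_taut[OF that] pi[OF that] by simp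
  have pi_diff: "fn (at (\<pi> i) (plus_one X)) z \<in> diff_set (onObj \<Gamma> i) X"
    if "i \<in> Obj I" "X \<in> U" "z \<in> diff_set L X" for i X z
    using diff_set_nat[OF piT[OF that(1)] that(2)] that pi[OF that(1)] by simp
  have at_pi: "fn (at (diff_nat U (\<pi> i)) X) z = fn (at (\<pi> i) (plus_one X)) z"
    if "i \<in> Obj I" "X \<in> U" "z \<in> diff_set L X" for i X z
    using that pi[OF that(1)] by simp
  have cone: "is_cone I FUN \<Delta>\<Gamma> (diff_fctr U L) (\<lambda>i. diff_nat U (\<pi> i))"
  proof (rule DG.coneI)
    show "set_functor (diff_fctr U L)" by (rule diff_fctr_set_functor[OF LT])
    show "is_nat U (diff_nat U (\<pi> i))" "nsrc (diff_nat U (\<pi> i)) = diff_fctr U L"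
      "ntgt (diff_nat U (\<pi> i)) = onObj \<Delta>\<Gamma> i" if "i \<in> Obj I" for i
      using diff_nat_is_nat[OF piA[OF that]] pi[OF that] onObj_diff[OF that] by simp_all
  next
    fix u X z assume u: "u \<in> Arr I" and X: "X \<in> U" and "z \<in> onObj (diff_fctr U L) X"
    then have z: "z \<in> diff_set L X" by simp
    note ij = G.ends_in_I[OF u] and t = G.edge_nat[OF u]
    have "fn (at (onArr \<Gamma> u) (plus_one X)) (fn (at (\<pi> (Dom I u)) (plus_one X)) z) =
        fn (at (\<pi> (Cod I u)) (plus_one X)) z"
      using z by (intro G.coneD(5)[OF c u plus_one_in_U[OF X]]) (simp add: diff_set_def)
    then show "fn (at (onArr \<Delta>\<Gamma> u) X) (fn (at (diff_nat U (\<pi> (Dom I u))) X) z) =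
        fn (at (diff_nat U (\<pi> (Cod I u))) X) z"
      using at_pi[OF _ X z] pi_diff[OF ij(1) X z] ij X t onArr_diff[OF u] by simp
  qed
  then show ?thesis
  proof (rule DG.pointwise_limitI)
    fix X x assume X: "X \<in> U" and x: "x \<in> DG.families X"
    have xi: "x i \<in> diff_set (onObj \<Gamma> i) X" if i: "i \<in> Obj I" for i
    proof -
      have "x i \<in> onObj (onObj \<Delta>\<Gamma> i) X" using x i by (auto simp: DG.families_def)
      then show ?thesis using X i by (simp add: onObj_diff)
    qed
    \<comment> \<open>A family of differences at \<open>X\<close> is also a compatible family of
      \<open>\<Gamma>\<close> at \<open>plus_one X\<close>, and the gluing is done at that
      stage.\<close>
    have "x i \<in> onObj (onObj \<Gamma> i) (plus_one X)" if "i \<in> Obj I" for i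
      using xi[OF that] by (simp add: diff_set_def)
    moreover have "fn (at (onArr \<Gamma> u) (plus_one X)) (x (Dom I u)) = x (Cod I u)" if u: "u \<in> Arr I" for u
    proof -
      have "fn (at (onArr \<Delta>\<Gamma> u) X) (x (Dom I u)) = x (Cod I u)"
        using x u by (simp add: DG.families_def)
      then show ?thesis
        using X xi[OF G.ends_in_I(1)[OF u]] G.edge_nat(2)[OF u] by (simp add: onArr_diff[OF u])
    qed
    ultimately obtain z where z: "z \<in> onObj L (plus_one X)"
      "\<And>i. i \<in> Obj I \<Longrightarrow> fn (at (\<pi> i) (plus_one X)) z = x i"
      using G.pointwise_limit_lift[OF L plus_one_in_U[OF X], of x] by metis
    have "z \<noteq> fn (onArr L (coprod_inj X)) w" if w: "w \<in> onObj L X" for w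
    proof
      assume zw: "z = fn (onArr L (coprod_inj X)) w"
      \<comment> \<open>Any single node gives the contradiction: a preimage \<open>w\<close> of
        \<open>z\<close> would provide \<open>x i\<close> with the preimage
        \<open>fn (at (\<pi> i) X) w\<close>, yet \<open>x i\<close> lies outside the image.\<close>
      obtain i where i: "i \<in> Obj I" using ne by (auto simp: nonempty_category_def)
      have "x i = fn (onArr (onObj \<Gamma> i) (coprod_inj X)) (fn (at (\<pi> i) X) w)"
        using G.cone_at(2)[OF c i coprod_inj_in_Arr[OF X], of w] w z(2)[OF i] zw by simp
      with xi[OF i] G.cone_at(1)[OF c i X w] show False by (auto simp: diff_set_def)
    qed
    with z(1) have zd: "z \<in> diff_set L X" by (auto simp: diff_set_def)
    show "\<exists>z\<in>onObj (diff_fctr U L) X. \<forall>i\<in>Obj I. fn (at (diff_nat U (\<pi> i)) X) z = x i"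
      using zd X at_pi[OF _ X zd] z(2) by (intro bexI[of _ z]) auto
  next
    fix X z z' assume X: "X \<in> U" and "z \<in> onObj (diff_fctr U L) X" "z' \<in> onObj (diff_fctr U L) X"
      and eq: "\<And>i. i \<in> Obj I \<Longrightarrow> fn (at (diff_nat U (\<pi> i)) X) z = fn (at (diff_nat U (\<pi> i)) X) z'"
    then have z: "z \<in> diff_set L X" "z' \<in> diff_set L X" by simp_all
    show "z = z'"
    proof (rule G.pointwise_limit_eqI[OF L plus_one_in_U[OF X]])
      fix i assume i: "i \<in> Obj I"
      show "fn (at (\<pi> i) (plus_one X)) z = fn (at (\<pi> i) (plus_one X)) z'"
        using eq[OF i] at_pi[OF i X] z by simp
    qed (use z in \<open>auto simp: diff_set_def\<close>)
  qed
qed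

end

section \<open>Comparison of arbitrary limits of the two diagrams\<close>

theorem theorem3p2p9:
  fixes U S :: "'u set set"
    and I :: "('i, 'k) cat"
    and \<Gamma> :: "('i, 'k, 'u set_fctr, 'u nat_arr) fctr"
  assumes "set_universe U S"
    and "is_category I"
    and "small_category S I"
    and "nonempty_category I"
    and "connected_category I"
    and "is_functor I (taut_cat U) \<Gamma>"
  shows "(\<exists>L \<pi>. is_limit I (fun_cat U) \<Gamma> L \<pi>) \<and>
    (\<exists>M \<mu>. is_limit I (fun_cat U) (fctr_comp I (Diff U) \<Gamma>) M \<mu>) \<and>
    (\<forall>L \<pi> M \<mu>. is_limit I (fun_cat U) \<Gamma> L \<pi> \<longrightarrow>
       is_limit I (fun_cat U) (fctr_comp I (Diff U) \<Gamma>) M \<mu> \<longrightarrow>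
       L \<in> Obj (taut_cat U) \<and> isomorphic_in (taut_cat U) (onObj (Diff U) L) M)"
proof -
  interpret taut_diagram U S I \<Gamma>
    using assms by unfold_locales
  have node_diff_taut: "taut_functor U (onObj \<Delta>\<Gamma> i)" if "i \<in> Obj I" for i
    using that by (simp add: onObj_diff diff_fctr_taut node_taut)
  show ?thesis
  proof (intro conjI allI impI)
    show "\<exists>L \<pi>. is_limit I FUN \<Gamma> L \<pi>"
      using G.pointwise_limit_exists[OF assms(3)] G.pointwise_limit_is_limit by blast
    show "\<exists>M \<mu>. is_limit I FUN \<Delta>\<Gamma> M \<mu>"
      using DG.pointwise_limit_exists[OF assms(3)] DG.pointwise_limit_is_limit by blast
  next
    fix L \<pi> M \<mu> assume limL: "is_limit I FUN \<Gamma> L \<pi>" and limM: "is_limit I FUN \<Delta>\<Gamma> M \<mu>"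
    note L = G.is_limit_pointwise[OF assms(3) limL] and M = DG.is_limit_pointwise[OF assms(3) limM]
    have LT: "taut_functor U L" by (rule G.pointwise_limit_taut[OF node_taut L])
    then show "L \<in> Obj TAUT" by simp
    have DT: "taut_functor U (diff_fctr U L)" by (rule diff_fctr_taut[OF LT])
    have MT: "taut_functor U M" by (rule DG.pointwise_limit_taut[OF node_diff_taut M])
    \<comment> \<open>The difference of \<open>L\<close> is itself a limit of the differences, so
      uniqueness of limits compares it with the arbitrary limit \<open>M\<close>.\<close>
    note limD = DG.pointwise_limit_is_limit[OF diff_pointwise_limit[OF assms(4,5) L]]
    obtain f g where f: "f \<in> hom FUN (diff_fctr U L) M" and g: "g \<in> hom FUN M (diff_fctr U L)"
      and gf: "Comp FUN g f = Idn FUN (diff_fctr U L)" and fg: "Comp FUN f g = Idn FUN M"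
      using limits_isomorphic[OF is_category_FUN limD limM] by blast
    have fD: "is_nat U f" "nsrc f = diff_fctr U L" "ntgt f = M" using f by (auto simp: hom_def)
    have gD: "is_nat U g" "nsrc g = M" "ntgt g = diff_fctr U L" using g by (auto simp: hom_def)
    \<comment> \<open>The comparison maps arise in \<open>FUN\<close>; each is taut because the
      other one undoes it.\<close>
    have "taut_nat U f"
      by (rule inverse_nat_taut[OF fD(1) gD(1)]) (simp_all only: fD gD DT MT gf)
    moreover have "taut_nat U g"
      by (rule inverse_nat_taut[OF gD(1) fD(1)]) (simp_all only: fD gD DT MT fg)
    ultimately have "f \<in> hom TAUT (diff_fctr U L) M" "g \<in> hom TAUT M (diff_fctr U L)"
      using fD gD DT MT by (simp_all add: hom_def)
    moreover have "onObj (Diff U) L = diff_fctr U L" using LT by (simp add: Diff_def)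
    ultimately show "isomorphic_in TAUT (onObj (Diff U) L) M"
      using gf fg DT MT unfolding isomorphic_in_def taut_cat_simps by auto
  qed
qed

end
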